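(* The class $\mathrm{CSA}^\ast$ is closed under extensions of centralizers by abelian groups without elements of order $2$. That is, let $G$ be a $\mathrm{CSA}^\ast$-group, $v\in G$, $C=C_G(v)$ the centralizer of $v$ in $G$, $A$ an abelian group without elements of order $2$, and $\phi:C\to A$ an injective homomorphism. Then the free product with amalgamation $$G(v,A)=\langle G\ast A\mid C=C^\phi\rangle$$ (amalgamating $c\in C\le G$ with $\phi(c)\in A$) is a $\mathrm{CSA}^\ast$-group.
   Context: A subgroup $H$ of a group $G$ is conjugately separated (malnormal) if $H\cap H^x=1$ for every $x\in G\setminus H$, where $H^x=x^{-1}Hx$. A group $G$ is a CSA-group if all its maximal abelian subgroups are conjugately separated. $\mathrm{CSA}^\ast$ is the class of all CSA-groups without elements of order $2$. The group $G(v,A)$ is called the extension of the centralizer $C_G(v)$ by the group $A$ with respect to $\phi$. *)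

theory Defs
  imports "HOL-Algebra.Multiplicative_Group"
begin

definition conjugately_separated :: "'a set \<Rightarrow> ('a, 'm) monoid_scheme \<Rightarrow> bool" where
  "conjugately_separated H G \<longleftrightarrow>
     (\<forall>x \<in> carrier G - H. H \<inter> ((inv\<^bsub>G\<^esub> x <#\<^bsub>G\<^esub> H) #>\<^bsub>G\<^esub> x) = {\<one>\<^bsub>G\<^esub>})"

definition abelian_subgroup :: "'a set \<Rightarrow> ('a, 'm) monoid_scheme \<Rightarrow> bool" where
  "abelian_subgroup H G \<longleftrightarrow> subgroup H G \<and> comm_group (G\<lparr>carrier := H\<rparr>)"

definition maximal_abelian_subgroup :: "'a set \<Rightarrow> ('a, 'm) monoid_scheme \<Rightarrow> bool" where
  "maximal_abelian_subgroup M G \<longleftrightarrow>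
     abelian_subgroup M G \<and> (\<forall>N. abelian_subgroup N G \<and> M \<subseteq> N \<longrightarrow> N = M)"

definition CSA_group :: "('a, 'm) monoid_scheme \<Rightarrow> bool" where
  "CSA_group G \<longleftrightarrow>
     group G \<and> (\<forall>M. maximal_abelian_subgroup M G \<longrightarrow> conjugately_separated M G)"

definition no_order_two :: "('a, 'm) monoid_scheme \<Rightarrow> bool" where
  "no_order_two G \<longleftrightarrow> (\<forall>x \<in> carrier G. group.ord G x \<noteq> 2)"

definition CSA_star :: "('a, 'm) monoid_scheme \<Rightarrow> bool" where
  "CSA_star G \<longleftrightarrow> CSA_group G \<and> no_order_two G"

definition centralizer :: "('a, 'm) monoid_scheme \<Rightarrow> 'a \<Rightarrow> 'a set" where
  "centralizer G v = {x \<in> carrier G. x \<otimes>\<^bsub>G\<^esub> v = v \<otimes>\<^bsub>G\<^esub> x}"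

text \<open>
  The free product of \<open>G\<close> and \<open>A\<close> amalgamating each \<open>c \<in> C\<close> with \<open>\<phi> c\<close> is presented by
  generators and relations: its elements are the words over the disjoint union of the two
  carriers, modulo the least congruence containing the multiplication tables of \<open>G\<close> and
  \<open>A\<close> and the pairs \<open>c = \<phi> c\<close>. Words need no formal inverses, since the inverse of a letter
  is again a letter up to this congruence.
\<close>

abbreviation words :: "('a, 'm) monoid_scheme \<Rightarrow> ('b, 'n) monoid_scheme \<Rightarrow> ('a + 'b) list set"
  where "words G A \<equiv> lists (carrier G <+> carrier A)"

inductive_set amalg_rel ::
  "('a, 'm) monoid_scheme \<Rightarrow> ('b, 'n) monoid_scheme \<Rightarrow> 'a set \<Rightarrow> ('a \<Rightarrow> 'b)
     \<Rightarrow> (('a + 'b) list \<times> ('a + 'b) list) set"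
  for G :: "('a, 'm) monoid_scheme" and A :: "('b, 'n) monoid_scheme"
    and C :: "'a set" and \<phi> :: "'a \<Rightarrow> 'b"
where
  refl: "w \<in> words G A \<Longrightarrow> (w, w) \<in> amalg_rel G A C \<phi>"
| sym: "(u, w) \<in> amalg_rel G A C \<phi> \<Longrightarrow> (w, u) \<in> amalg_rel G A C \<phi>"
| trans: "(u, w) \<in> amalg_rel G A C \<phi> \<Longrightarrow> (w, z) \<in> amalg_rel G A C \<phi> \<Longrightarrow>
     (u, z) \<in> amalg_rel G A C \<phi>"
| append: "(u, u') \<in> amalg_rel G A C \<phi> \<Longrightarrow> (w, w') \<in> amalg_rel G A C \<phi> \<Longrightarrow>
     (u @ w, u' @ w') \<in> amalg_rel G A C \<phi>"
| left_one: "([Inl \<one>\<^bsub>G\<^esub>], []) \<in> amalg_rel G A C \<phi>"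
| right_one: "([Inr \<one>\<^bsub>A\<^esub>], []) \<in> amalg_rel G A C \<phi>"
| left_mult: "x \<in> carrier G \<Longrightarrow> y \<in> carrier G \<Longrightarrow>
     ([Inl x, Inl y], [Inl (x \<otimes>\<^bsub>G\<^esub> y)]) \<in> amalg_rel G A C \<phi>"
| right_mult: "x \<in> carrier A \<Longrightarrow> y \<in> carrier A \<Longrightarrow>
     ([Inr x, Inr y], [Inr (x \<otimes>\<^bsub>A\<^esub> y)]) \<in> amalg_rel G A C \<phi>"
| amalg: "c \<in> C \<Longrightarrow> ([Inl c], [Inr (\<phi> c)]) \<in> amalg_rel G A C \<phi>"

definition amalgamated_product ::
  "('a, 'm) monoid_scheme \<Rightarrow> ('b, 'n) monoid_scheme \<Rightarrow> 'a set \<Rightarrow> ('a \<Rightarrow> 'b)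
     \<Rightarrow> ('a + 'b) list set monoid" where
  "amalgamated_product G A C \<phi> =
     \<lparr>carrier = words G A // amalg_rel G A C \<phi>,
      mult = (\<lambda>X Y. \<Union>u \<in> X. \<Union>w \<in> Y. amalg_rel G A C \<phi> `` {u @ w}),
      one = amalg_rel G A C \<phi> `` {[]}\<rparr>"

definition centralizer_extension ::
  "('a, 'm) monoid_scheme \<Rightarrow> 'a \<Rightarrow> ('b, 'n) monoid_scheme \<Rightarrow> ('a \<Rightarrow> 'b)
     \<Rightarrow> ('a + 'b) list set monoid" where
  "centralizer_extension G v A \<phi> = amalgamated_product G A (centralizer G v) \<phi>"

text \<open>
  The construction is the pushout of the inclusion \<open>C \<rightarrow> G\<close> and \<open>\<phi> : C \<rightarrow> A\<close> in the category of
  groups: it is a group, the two factors map to it compatibly, and homomorphisms out of the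
  factors that agree on \<open>C\<close> extend uniquely.
\<close>

locale amalgam = G: group G + A: group A
  for G :: "('a, 'm) monoid_scheme" and A :: "('b, 'n) monoid_scheme" +
  fixes C :: "'a set" and \<phi> :: "'a \<Rightarrow> 'b"
  assumes C_sub: "C \<subseteq> carrier G" and phi_closed: "\<phi> ` C \<subseteq> carrier A"
begin

abbreviation "R \<equiv> amalg_rel G A C \<phi>"
abbreviation "P \<equiv> amalgamated_product G A C \<phi>"
definition cls :: "('a + 'b) list \<Rightarrow> ('a + 'b) list set" where "cls w = R `` {w}"

declare in_lists_conv_set [simp del] and in_listsD [rule del] and in_listsI [rule del]

lemma in_letters_iff [simp]:
  "Inl x \<in> carrier G <+> carrier A \<longleftrightarrow> x \<in> carrier G"
  "Inr a \<in> carrier G <+> carrier A \<longleftrightarrow> a \<in> carrier A"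
  by auto

lemma in_cls_iff: "u \<in> cls w \<longleftrightarrow> (w, u) \<in> R"
  by (simp add: cls_def)

lemma rel_words: "(u, w) \<in> R \<Longrightarrow> u \<in> words G A \<and> w \<in> words G A"
  by (induction rule: amalg_rel.induct) (use C_sub phi_closed in auto)

lemma equiv_rel: "equiv (words G A) R"
proof (rule equivI)
  show "R \<subseteq> words G A \<times> words G A" by (auto dest: rel_words)
  show "refl_on (words G A) R" by (auto intro: refl_onI amalg_rel.refl)
  show "sym R" by (auto intro: symI amalg_rel.sym)
  show "trans R" by (blast intro: transI amalg_rel.trans)
qed

lemma cls_eq_iff: "u \<in> words G A \<Longrightarrow> w \<in> words G A \<Longrightarrow> cls u = cls w \<longleftrightarrow> (u, w) \<in> R"
  unfolding cls_def using eq_equiv_class_iff[OF equiv_rel] by blast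

lemma cls_eqI: "(u, w) \<in> R \<Longrightarrow> cls u = cls w"
  unfolding cls_def using equiv_class_eq[OF equiv_rel] by blast

lemma carrier_P: "carrier P = cls ` words G A"
  by (auto simp: amalgamated_product_def quotient_def cls_def)

lemma one_P: "\<one>\<^bsub>P\<^esub> = cls []"
  by (simp add: amalgamated_product_def cls_def)

lemma mult_P:
  assumes "u \<in> words G A" "w \<in> words G A"
  shows "cls u \<otimes>\<^bsub>P\<^esub> cls w = cls (u @ w)"
proof -
  have *: "cls (u' @ w') = cls (u @ w)" if "u' \<in> cls u" "w' \<in> cls w" for u' w'
    using that by (intro cls_eqI amalg_rel.append) (auto simp: in_cls_iff intro: amalg_rel.sym)
  have "u \<in> cls u" "w \<in> cls w"
    using assms by (auto simp: in_cls_iff intro: amalg_rel.refl)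
  then show ?thesis
    unfolding amalgamated_product_def monoid.simps cls_def[symmetric] using * by blast
qed

lemma left_inverse:
  assumes "w \<in> words G A"
  shows "\<exists>u \<in> words G A. (u @ w, []) \<in> R"
  using assms
proof (induction w rule: list.induct)
  case Nil
  show ?case by (intro bexI[of _ "[]"]) (auto intro: amalg_rel.refl)
next
  case (Cons x w)
  then obtain u where u: "u \<in> words G A" "(u @ w, []) \<in> R" by auto
  obtain y where y: "y \<in> carrier G <+> carrier A" "([y, x], []) \<in> R"
  proof (cases x)
    case (Inl g)
    with Cons.prems have g: "g \<in> carrier G" by simp
    have "([Inl (inv\<^bsub>G\<^esub> g), Inl g], [Inl \<one>\<^bsub>G\<^esub>]) \<in> R"
      using amalg_rel.left_mult[of "inv\<^bsub>G\<^esub> g" G g A C \<phi>] g by simp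
    then have "([Inl (inv\<^bsub>G\<^esub> g), Inl g], []) \<in> R"
      using amalg_rel.left_one by (rule amalg_rel.trans)
    with Inl g that[of "Inl (inv\<^bsub>G\<^esub> g)"] show ?thesis by simp
  next
    case (Inr a)
    with Cons.prems have a: "a \<in> carrier A" by simp
    have "([Inr (inv\<^bsub>A\<^esub> a), Inr a], [Inr \<one>\<^bsub>A\<^esub>]) \<in> R"
      using amalg_rel.right_mult[of "inv\<^bsub>A\<^esub> a" A a G C \<phi>] a by simp
    then have "([Inr (inv\<^bsub>A\<^esub> a), Inr a], []) \<in> R"
      using amalg_rel.right_one by (rule amalg_rel.trans)
    with Inr a that[of "Inr (inv\<^bsub>A\<^esub> a)"] show ?thesis by simp
  qed
  have "w \<in> words G A" using Cons.prems by simp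
  then have "(u @ ([y, x] @ w), u @ ([] @ w)) \<in> R"
    using u(1) y(2) by (intro amalg_rel.append amalg_rel.refl)
  with u(2) have "((u @ [y]) @ (x # w), []) \<in> R"
    by (auto intro: amalg_rel.trans)
  with u(1) y(1) show ?case by (intro bexI[of _ "u @ [y]"]) auto
qed

lemma group_P: "group P"
proof (rule groupI)
  fix X assume "X \<in> carrier P"
  then obtain w where w: "w \<in> words G A" "X = cls w" by (auto simp: carrier_P)
  obtain u where "u \<in> words G A" "(u @ w, []) \<in> R" using left_inverse[OF w(1)] by blast
  then show "\<exists>Y \<in> carrier P. Y \<otimes>\<^bsub>P\<^esub> X = \<one>\<^bsub>P\<^esub>"
    by (intro bexI[of _ "cls u"]) (simp_all add: w mult_P one_P carrier_P cls_eqI)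
qed (auto simp: carrier_P mult_P one_P)

definition emb_left :: "'a \<Rightarrow> ('a + 'b) list set" where "emb_left x = cls [Inl x]"
definition emb_right :: "'b \<Rightarrow> ('a + 'b) list set" where "emb_right a = cls [Inr a]"

lemma emb_left_hom: "emb_left \<in> hom G P"
  by (rule homI)
    (simp_all add: emb_left_def carrier_P mult_P cls_eqI[OF amalg_rel.left_mult])

lemma emb_right_hom: "emb_right \<in> hom A P"
  by (rule homI)
    (simp_all add: emb_right_def carrier_P mult_P cls_eqI[OF amalg_rel.right_mult])

lemma emb_agree: "c \<in> C \<Longrightarrow> emb_left c = emb_right (\<phi> c)"
  unfolding emb_left_def emb_right_def by (intro cls_eqI amalg_rel.amalg)

lemma extend_hom:
  fixes K :: "('c, 'k) monoid_scheme"
  assumes K: "group K" and f: "f \<in> hom G K" and g: "g \<in> hom A K"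
    and fg: "\<And>c. c \<in> C \<Longrightarrow> f c = g (\<phi> c)"
  shows "\<exists>h \<in> hom P K. (\<forall>x \<in> carrier G. h (emb_left x) = f x)
                      \<and> (\<forall>a \<in> carrier A. h (emb_right a) = g a)"
proof -
  interpret K: group K by fact
  interpret f: group_hom G K f by unfold_locales (rule f)
  interpret g: group_hom A K g by unfold_locales (rule g)
  define ev where "ev w = foldr (\<lambda>x k. case_sum f g x \<otimes>\<^bsub>K\<^esub> k) w \<one>\<^bsub>K\<^esub>" for w
  have ev_closed: "ev w \<in> carrier K" if "w \<in> words G A" for w
    using that by (induction w rule: list.induct) (auto simp: ev_def)
  have ev_append: "ev (u @ w) = ev u \<otimes>\<^bsub>K\<^esub> ev w" if "u \<in> words G A" "w \<in> words G A" for u w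
    using that(1)
  proof (induction u rule: list.induct)
    case Nil
    show ?case using ev_closed[OF that(2)] by (simp add: ev_def)
  next
    case (Cons x u)
    then have "case_sum f g x \<in> carrier K" by auto
    with Cons ev_closed[of u] ev_closed[OF that(2)] show ?case
      by (simp add: ev_def K.m_assoc)
  qed
  have ev_rel: "ev u = ev w" if "(u, w) \<in> R" for u w
    using that
  proof (induction rule: amalg_rel.induct)
    case (append u u' w w')
    then show ?case using rel_words by (metis ev_append)
  next
    case (amalg c)
    then show ?case using fg by (simp add: ev_def)
  qed (auto simp: ev_def)
  define h where "h X = ev (SOME w. w \<in> X)" for X
  have h: "h (cls w) = ev w" if "w \<in> words G A" for w
  proof -
    have "w \<in> cls w" using that by (auto simp: in_cls_iff intro: amalg_rel.refl)
    then have "(SOME u. u \<in> cls w) \<in> cls w" by (rule someI)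
    then show ?thesis unfolding h_def using ev_rel unfolding in_cls_iff by force
  qed
  show ?thesis
  proof (intro bexI[of _ h] conjI ballI)
    show "h \<in> hom P K"
      by (auto intro!: homI simp: carrier_P mult_P h ev_append ev_closed)
    show "h (emb_left x) = f x" if "x \<in> carrier G" for x
      using that by (simp add: emb_left_def h) (simp add: ev_def)
    show "h (emb_right a) = g a" if "a \<in> carrier A" for a
      using that by (simp add: emb_right_def h) (simp add: ev_def)
  qed
qed

lemma extend_hom_unique:
  fixes K :: "('c, 'k) monoid_scheme"
  assumes K: "group K" and h: "h \<in> hom P K" and h': "h' \<in> hom P K"
    and left: "\<And>x. x \<in> carrier G \<Longrightarrow> h (emb_left x) = h' (emb_left x)"
    and right: "\<And>a. a \<in> carrier A \<Longrightarrow> h (emb_right a) = h' (emb_right a)"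
    and X: "X \<in> carrier P"
  shows "h X = h' X"
proof -
  interpret h: group_hom P K h
    by (intro group_hom.intro group_hom_axioms.intro group_P K h)
  interpret h': group_hom P K h'
    by (intro group_hom.intro group_hom_axioms.intro group_P K h')
  have "h (cls w) = h' (cls w)" if "w \<in> words G A" for w
    using that
  proof (induction w rule: list.induct)
    case Nil
    show ?case using h.hom_one h'.hom_one by (simp add: one_P)
  next
    case (Cons x w)
    have split: "cls (x # w) = cls [x] \<otimes>\<^bsub>P\<^esub> cls w"
      using Cons.prems by (simp add: mult_P)
    have letter: "h (cls [x]) = h' (cls [x])"
      using Cons.prems left right unfolding emb_left_def emb_right_def by (cases x) simp_all
    have "cls [x] \<in> carrier P" "cls w \<in> carrier P"
      using Cons.prems by (auto simp: carrier_P)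
    then show ?case
      using Cons letter by (simp add: split)
  qed
  with X show ?thesis by (auto simp: carrier_P)
qed

end

end

theory Submission
  imports Defs "HOL-Algebra.Bij"
begin

text \<open>
  A group is CSA iff for every nontrivial \<open>a\<close> the centralizer of \<open>a\<close> is abelian, and \<open>x\<close> commutes
  with \<open>a\<close> as soon as \<open>a\<^sup>x\<close> does. Hence \<open>C = C\<^sub>G(v)\<close> is malnormal in \<open>G\<close> (or \<open>v = 1\<close> and \<open>C = G\<close>).
  Van der Waerden's action on normal forms gives the syllable length \<open>L\<close> on the amalgam, and
  \<open>L (x y\<inverse>)\<close> is the distance of two edges of the Bass--Serre tree, so it satisfies the
  four-point condition.

  If no conjugate of \<open>a\<close> lies in a factor, then \<open>L (a\<^sup>n)\<close> tends to infinity. The Busemann function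
  \<open>lim (L (a\<^sup>n x) - L (a\<^sup>n))\<close> is a homomorphism on the centralizer of \<open>a\<close>; an element of its kernel
  has bounded powers, hence is conjugate into a factor, hence trivial. So the centralizer
  embeds into the integers, and if \<open>a\<^sup>x\<close> lies in it, a comparison of lengths gives \<open>a\<^sup>x = a\<close> or
  \<open>a\<^sup>x = a\<inverse>\<close>. In the second case conjugation by \<open>x\<close> inverts the centralizer but fixes \<open>x\<^sup>2\<close>, so
  \<open>x\<^sup>4 = 1\<close> and \<open>x = 1\<close>.

  If \<open>a\<close> lies in a factor, reduced words and malnormality of \<open>C\<close> show that \<open>A\<close> is malnormal in the
  amalgam, and that \<open>a\<^sup>x \<in> G\<close> forces \<open>x \<in> G\<close> when \<open>a \<in> G\<close> is not conjugate into \<open>C\<close>. Everything then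
  takes place inside a factor.
\<close>

section \<open>CSA-groups through commutation\<close>

text \<open>Both clauses concern one element, so that elements conjugate into a factor and all
  others can be treated separately. Required of every nontrivial element, they make centralizers of
  nontrivial elements abelian and malnormal.\<close>

definition CSA_element :: "('a, 'm) monoid_scheme \<Rightarrow> 'a \<Rightarrow> bool" where
  "CSA_element G a \<longleftrightarrow>
     (\<forall>x \<in> carrier G. \<forall>y \<in> carrier G. x \<otimes>\<^bsub>G\<^esub> a = a \<otimes>\<^bsub>G\<^esub> x \<longrightarrow> y \<otimes>\<^bsub>G\<^esub> a = a \<otimes>\<^bsub>G\<^esub> y \<longrightarrow>
        x \<otimes>\<^bsub>G\<^esub> y = y \<otimes>\<^bsub>G\<^esub> x) \<and>
     (\<forall>x \<in> carrier G. (inv\<^bsub>G\<^esub> x \<otimes>\<^bsub>G\<^esub> a \<otimes>\<^bsub>G\<^esub> x) \<otimes>\<^bsub>G\<^esub> a = a \<otimes>\<^bsub>G\<^esub> (inv\<^bsub>G\<^esub> x \<otimes>\<^bsub>G\<^esub> a \<otimes>\<^bsub>G\<^esub> x) \<longrightarrow>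
        x \<otimes>\<^bsub>G\<^esub> a = a \<otimes>\<^bsub>G\<^esub> x)"

lemma CSA_elementD:
  assumes "CSA_element G a"
  shows "\<lbrakk>x \<in> carrier G; y \<in> carrier G; x \<otimes>\<^bsub>G\<^esub> a = a \<otimes>\<^bsub>G\<^esub> x; y \<otimes>\<^bsub>G\<^esub> a = a \<otimes>\<^bsub>G\<^esub> y\<rbrakk>
      \<Longrightarrow> x \<otimes>\<^bsub>G\<^esub> y = y \<otimes>\<^bsub>G\<^esub> x"
    and "\<lbrakk>x \<in> carrier G; (inv\<^bsub>G\<^esub> x \<otimes>\<^bsub>G\<^esub> a \<otimes>\<^bsub>G\<^esub> x) \<otimes>\<^bsub>G\<^esub> a = a \<otimes>\<^bsub>G\<^esub> (inv\<^bsub>G\<^esub> x \<otimes>\<^bsub>G\<^esub> a \<otimes>\<^bsub>G\<^esub> x)\<rbrakk>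
      \<Longrightarrow> x \<otimes>\<^bsub>G\<^esub> a = a \<otimes>\<^bsub>G\<^esub> x"
  using assms unfolding CSA_element_def by blast+

context group
begin

section \<open>Commutation and conjugation identities\<close>

lemma inv_commute:
  assumes "x \<in> carrier G" "y \<in> carrier G" "x \<otimes> y = y \<otimes> x"
  shows "inv x \<otimes> y = y \<otimes> inv x"
proof -
  have "inv x \<otimes> y = inv x \<otimes> (y \<otimes> x) \<otimes> inv x"
    using assms(1,2) by (simp add: m_assoc)
  also have "\<dots> = inv x \<otimes> (x \<otimes> y) \<otimes> inv x"
    using assms(3) by simp
  also have "\<dots> = y \<otimes> inv x"
    using assms(1,2) by (simp add: m_assoc[symmetric])
  finally show ?thesis .
qed

lemma mult_commute:
  assumes "x \<in> carrier G" "y \<in> carrier G" "z \<in> carrier G" "x \<otimes> z = z \<otimes> x" "y \<otimes> z = z \<otimes> y"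
  shows "x \<otimes> y \<otimes> z = z \<otimes> (x \<otimes> y)"
  using assms by (metis m_assoc)

lemma conj_closed [simp]:
  "x \<in> carrier G \<Longrightarrow> a \<in> carrier G \<Longrightarrow> inv x \<otimes> a \<otimes> x \<in> carrier G"
  by simp

lemma conj_mult:
  assumes "p \<in> carrier G" "a \<in> carrier G" "b \<in> carrier G"
  shows "inv p \<otimes> (a \<otimes> b) \<otimes> p = (inv p \<otimes> a \<otimes> p) \<otimes> (inv p \<otimes> b \<otimes> p)"
proof -
  have "p \<otimes> (inv p \<otimes> (b \<otimes> p)) = b \<otimes> p"
    using assms by (simp add: m_assoc[symmetric])
  then show ?thesis using assms by (simp add: m_assoc)
qed

lemma conj_conj:
  assumes "p \<in> carrier G" "q \<in> carrier G" "a \<in> carrier G"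
  shows "inv q \<otimes> (inv p \<otimes> a \<otimes> p) \<otimes> q = inv (p \<otimes> q) \<otimes> a \<otimes> (p \<otimes> q)"
  using assms by (simp add: m_assoc inv_mult_group)

lemma conj_inv_conj [simp]:
  assumes "p \<in> carrier G" "a \<in> carrier G"
  shows "p \<otimes> (inv p \<otimes> a \<otimes> p) \<otimes> inv p = a"
  using conj_conj[of p "inv p" a] assms by simp

lemma conj_inv:
  assumes "p \<in> carrier G" "a \<in> carrier G"
  shows "inv p \<otimes> inv a \<otimes> p = inv (inv p \<otimes> a \<otimes> p)"
  using assms by (simp add: m_assoc inv_mult_group)

lemma conj_inj:
  assumes "p \<in> carrier G" "a \<in> carrier G" "b \<in> carrier G"
    and "inv p \<otimes> a \<otimes> p = inv p \<otimes> b \<otimes> p"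
  shows "a = b"
  using assms by simp

lemma conj_eq_one_iff:
  assumes "p \<in> carrier G" "a \<in> carrier G"
  shows "inv p \<otimes> a \<otimes> p = \<one> \<longleftrightarrow> a = \<one>"
  using conj_inj[OF assms one_closed] assms by auto

lemma conj_pow:
  assumes "p \<in> carrier G" "a \<in> carrier G"
  shows "(inv p \<otimes> a \<otimes> p) [^] (n::nat) = inv p \<otimes> a [^] n \<otimes> p"
proof (induction n)
  case (Suc n)
  then show ?case using assms by (simp add: conj_mult[symmetric])
qed (use assms in simp)

lemma conj_fixes_iff:
  assumes "x \<in> carrier G" "a \<in> carrier G"
  shows "inv x \<otimes> a \<otimes> x = a \<longleftrightarrow> x \<otimes> a = a \<otimes> x"
  using assms by (metis inv_solve_left inv_closed m_assoc m_closed)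

text \<open>Conjugation by \<open>p\<close> is an automorphism, and both clauses are built from
  products and inverses only. This permits passing to a conjugate that lies in a factor.\<close>

lemma CSA_element_conj:
  assumes p: "p \<in> carrier G" and a: "a \<in> carrier G"
    and good: "CSA_element G (inv p \<otimes> a \<otimes> p)"
  shows "CSA_element G a"
proof -
  define c where "c x = inv p \<otimes> x \<otimes> p" for x
  have closed: "c x \<in> carrier G" if "x \<in> carrier G" for x
    using that p by (simp add: c_def)
  have mult: "c (x \<otimes> y) = c x \<otimes> c y" if "x \<in> carrier G" "y \<in> carrier G" for x y
    unfolding c_def using p that by (rule conj_mult)
  have inverse: "c (inv x) = inv (c x)" if "x \<in> carrier G" for x
    unfolding c_def using p that by (rule conj_inv)
  have comm: "x \<otimes> y = y \<otimes> x \<longleftrightarrow> c x \<otimes> c y = c y \<otimes> c x"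
    if "x \<in> carrier G" "y \<in> carrier G" for x y
    using that conj_inj[OF p, of "x \<otimes> y" "y \<otimes> x"]
    by (auto simp: mult[symmetric] c_def[symmetric])
  have conj: "c (inv x \<otimes> a \<otimes> x) = inv (c x) \<otimes> c a \<otimes> c x" if "x \<in> carrier G" for x
    using that a by (simp add: mult inverse)
  note good' = good[folded c_def, unfolded CSA_element_def]
  show ?thesis
    unfolding CSA_element_def
  proof (intro conjI ballI impI)
    fix x y assume xy: "x \<in> carrier G" "y \<in> carrier G" "x \<otimes> a = a \<otimes> x" "y \<otimes> a = a \<otimes> y"
    then have "c x \<otimes> c y = c y \<otimes> c x"
      using good' comm[of x a] comm[of y a] closed a by blast
    then show "x \<otimes> y = y \<otimes> x" using comm[of x y] xy by blast
  next
    fix x assume x: "x \<in> carrier G" "(inv x \<otimes> a \<otimes> x) \<otimes> a = a \<otimes> (inv x \<otimes> a \<otimes> x)"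
    then have "(inv (c x) \<otimes> c a \<otimes> c x) \<otimes> c a = c a \<otimes> (inv (c x) \<otimes> c a \<otimes> c x)"
      using comm[of "inv x \<otimes> a \<otimes> x" a] conj[OF x(1)] a by simp
    then have "c x \<otimes> c a = c a \<otimes> c x" using good' closed x(1) by blast
    then show "x \<otimes> a = a \<otimes> x" using comm[of x a] x a by blast
  qed
qed

text \<open>Zorn's lemma is applied to commuting subsets rather than subgroups, so unions of chains
  need no closure argument. A maximal commuting subset is its own centralizer and therefore a
  subgroup.\<close>

lemma exists_maximal_abelian_subgroup:
  assumes S: "S \<subseteq> carrier G" and comm: "\<And>x y. x \<in> S \<Longrightarrow> y \<in> S \<Longrightarrow> x \<otimes> y = y \<otimes> x"
  obtains M where "maximal_abelian_subgroup M G" "S \<subseteq> M"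
proof -
  define F where
    "F = {M. S \<subseteq> M \<and> M \<subseteq> carrier G \<and> (\<forall>x \<in> M. \<forall>y \<in> M. x \<otimes> y = y \<otimes> x)}"
  have "\<exists>M \<in> F. \<forall>X \<in> F. M \<subseteq> X \<longrightarrow> X = M"
  proof (rule subset_Zorn_nonempty)
    show "F \<noteq> {}" using S comm by (auto simp: F_def)
    fix K assume K: "K \<noteq> {}" "subset.chain F K"
    have total: "X \<subseteq> Y \<or> Y \<subseteq> X" if "X \<in> K" "Y \<in> K" for X Y
      using K(2) that by (auto simp: subset_chain_def)
    have sub: "K \<subseteq> F" using K(2) by (auto simp: subset_chain_def)
    have "x \<otimes> y = y \<otimes> x" if xy: "x \<in> \<Union>K" "y \<in> \<Union>K" for x y
    proof -
      obtain X Y where XY: "X \<in> K" "x \<in> X" "Y \<in> K" "y \<in> Y" using xy by auto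
      obtain Z where "Z \<in> K" "x \<in> Z" "y \<in> Z" using total[OF XY(1,3)] XY by auto
      then show ?thesis using sub by (auto simp: F_def)
    qed
    moreover obtain X where "X \<in> K" using K(1) by blast
    then have "S \<subseteq> \<Union>K" using sub unfolding F_def by blast
    ultimately show "\<Union>K \<in> F" using sub by (auto simp: F_def)
  qed
  then obtain M where M: "M \<in> F" and max: "\<And>X. X \<in> F \<Longrightarrow> M \<subseteq> X \<Longrightarrow> X = M" by auto
  have Mc: "M \<subseteq> carrier G" and SM: "S \<subseteq> M"
    and Mcomm: "\<And>x y. x \<in> M \<Longrightarrow> y \<in> M \<Longrightarrow> x \<otimes> y = y \<otimes> x"
    using M by (auto simp: F_def)
  \<comment> \<open>An element commuting with all of \<open>M\<close> could be adjoined, so it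
    already lies in \<open>M\<close>; closure under products and inverses follows.\<close>
  have in_M: "x \<in> M" if "x \<in> carrier G" "\<And>y. y \<in> M \<Longrightarrow> x \<otimes> y = y \<otimes> x" for x
  proof -
    have "insert x M \<in> F" using that Mc SM Mcomm by (auto simp: F_def)
    then show ?thesis using max[of "insert x M"] by blast
  qed
  have "subgroup M G"
  proof (rule subgroupI)
    show "M \<noteq> {}" using in_M[OF one_closed] Mc by auto
    fix a assume a: "a \<in> M"
    show "inv a \<in> M"
      using a Mc Mcomm by (intro in_M inv_commute) auto
    fix b assume "b \<in> M"
    then show "a \<otimes> b \<in> M"
      using a Mc Mcomm by (intro in_M mult_commute) auto
  qed (use Mc in auto)
  moreover from this have "comm_group (G\<lparr>carrier := M\<rparr>)"
    using Mcomm by (intro group.group_comm_groupI subgroup_imp_group) auto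
  moreover have "N = M" if "abelian_subgroup N G" "M \<subseteq> N" for N
  proof (rule max)
    interpret N: comm_group "G\<lparr>carrier := N\<rparr>" using that(1) by (simp add: abelian_subgroup_def)
    show "N \<in> F"
      using that SM N.m_comm subgroup.subset[of N G] by (auto simp: F_def abelian_subgroup_def)
  qed (use that in auto)
  ultimately show thesis
    using that[of M] SM by (auto simp: maximal_abelian_subgroup_def abelian_subgroup_def)
qed

lemma conjugate_set: "(inv x <# H) #> x = (\<lambda>h. inv x \<otimes> h \<otimes> x) ` H"
  by (auto simp: l_coset_def r_coset_def)

text \<open>Forwards, \<open>a\<close> and an element commuting with it lie in one maximal abelian
  \<open>M\<close>, and malnormality of \<open>M\<close> captures further elements. Backwards, a
  nontrivial \<open>h\<close> in \<open>M\<close> with conjugate by \<open>x\<close> in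
  \<open>M\<close> forces \<open>x\<close> to commute with \<open>h\<close>, then with all of
  \<open>M\<close>, against maximality.\<close>

lemma CSA_group_iff:
  "CSA_group G \<longleftrightarrow> (\<forall>a \<in> carrier G - {\<one>}. CSA_element G a)"
proof (intro iffI ballI)
  fix a assume csa: "CSA_group G" and "a \<in> carrier G - {\<one>}"
  then have a: "a \<in> carrier G" "a \<noteq> \<one>" by auto
  have max: "\<exists>M. subgroup M G \<and> (\<forall>x \<in> M. \<forall>y \<in> M. x \<otimes> y = y \<otimes> x) \<and> a \<in> M \<and> b \<in> M \<and>
      (\<forall>x \<in> carrier G - M. \<forall>h \<in> M. inv x \<otimes> h \<otimes> x \<in> M \<longrightarrow> h = \<one>)"
    if b: "b \<in> carrier G" "b \<otimes> a = a \<otimes> b" for b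
  proof -
    obtain M where M: "maximal_abelian_subgroup M G" "{a, b} \<subseteq> M"
    proof (rule exists_maximal_abelian_subgroup)
      show "{a, b} \<subseteq> carrier G" using a b by simp
      show "x \<otimes> y = y \<otimes> x" if "x \<in> {a, b}" "y \<in> {a, b}" for x y
        using that b(2) by (elim insertE emptyE) simp_all
    qed
    then have sub: "subgroup M G" "comm_group (G\<lparr>carrier := M\<rparr>)"
      by (auto simp: maximal_abelian_subgroup_def abelian_subgroup_def)
    interpret M: comm_group "G\<lparr>carrier := M\<rparr>" by (rule sub)
    have "conjugately_separated M G" using csa M(1) by (auto simp: CSA_group_def)
    then have sep: "M \<inter> (\<lambda>h. inv x \<otimes> h \<otimes> x) ` M = {\<one>}" if "x \<in> carrier G - M" for x
      using that unfolding conjugately_separated_def conjugate_set by blast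
    have mal: "h = \<one>" if "x \<in> carrier G - M" "h \<in> M" "inv x \<otimes> h \<otimes> x \<in> M" for x h
    proof -
      have "inv x \<otimes> h \<otimes> x = \<one>" using sep[OF that(1)] that(2,3) by blast
      moreover have "x \<in> carrier G" "h \<in> carrier G"
        using that(1) subgroup.mem_carrier[OF sub(1) that(2)] by auto
      ultimately show ?thesis using conj_eq_one_iff by blast
    qed
    have "x \<otimes> y = y \<otimes> x" if "x \<in> M" "y \<in> M" for x y
      using M.m_comm[of x y] that by simp
    with sub(1) M(2) mal show ?thesis by blast
  qed
  show "CSA_element G a"
    unfolding CSA_element_def
  proof (intro conjI ballI impI)
    fix x y assume xy: "x \<in> carrier G" "y \<in> carrier G" "x \<otimes> a = a \<otimes> x" "y \<otimes> a = a \<otimes> y"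
    obtain M where M: "\<forall>x \<in> M. \<forall>y \<in> M. x \<otimes> y = y \<otimes> x" "a \<in> M" "x \<in> M"
      "\<forall>x \<in> carrier G - M. \<forall>h \<in> M. inv x \<otimes> h \<otimes> x \<in> M \<longrightarrow> h = \<one>"
      using max[OF xy(1,3)] by blast
    \<comment> \<open>\<open>y\<close> fixes the nontrivial element \<open>a\<close> of
      \<open>M\<close>, so it cannot lie outside the malnormal \<open>M\<close>.\<close>
    have "inv y \<otimes> a \<otimes> y = a" using conj_fixes_iff[OF xy(2) a(1)] xy(4) by simp
    then have "y \<in> M" using M(4)[rule_format, of y a] M(2) xy(2) a(2) by auto
    then show "x \<otimes> y = y \<otimes> x" using M by auto
  next
    fix x assume x: "x \<in> carrier G"
      "(inv x \<otimes> a \<otimes> x) \<otimes> a = a \<otimes> (inv x \<otimes> a \<otimes> x)"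
    obtain M where M: "\<forall>x \<in> M. \<forall>y \<in> M. x \<otimes> y = y \<otimes> x" "a \<in> M" "inv x \<otimes> a \<otimes> x \<in> M"
      "\<forall>x \<in> carrier G - M. \<forall>h \<in> M. inv x \<otimes> h \<otimes> x \<in> M \<longrightarrow> h = \<one>"
      using max[OF conj_closed[OF x(1) a(1)] x(2)] by blast
    then have "x \<in> M" using M(4)[rule_format, of x a] x(1) a(2) by auto
    then show "x \<otimes> a = a \<otimes> x" using M by auto
  qed
next
  assume good: "\<forall>a \<in> carrier G - {\<one>}. CSA_element G a"
  show "CSA_group G"
    unfolding CSA_group_def
  proof (intro conjI allI impI is_group)
    fix M assume M: "maximal_abelian_subgroup M G"
    then have sub: "subgroup M G" "comm_group (G\<lparr>carrier := M\<rparr>)"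
      by (auto simp: maximal_abelian_subgroup_def abelian_subgroup_def)
    interpret M: comm_group "G\<lparr>carrier := M\<rparr>" by (rule sub)
    have Mcomm: "x \<otimes> y = y \<otimes> x" if "x \<in> M" "y \<in> M" for x y
      using M.m_comm that by simp
    have Mc: "x \<in> carrier G" if "x \<in> M" for x
      using subgroup.mem_carrier[OF sub(1) that] .
    have mal: "h = \<one>" if x: "x \<in> carrier G" "x \<notin> M" and h: "h \<in> M" "inv x \<otimes> h \<otimes> x \<in> M" for x h
    proof (rule ccontr)
      assume "h \<noteq> \<one>"
      with good h(1) Mc have e: "CSA_element G h" by blast
      have xh: "x \<otimes> h = h \<otimes> x"
        by (rule CSA_elementD(2)[OF e x(1) Mcomm[OF h(2,1)]])
      have ch: "a \<in> carrier G" "a \<otimes> h = h \<otimes> a" if "a \<in> insert x M" for a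
      proof -
        show "a \<in> carrier G" using that x(1) Mc by blast
        show "a \<otimes> h = h \<otimes> a"
          using xh Mcomm[OF _ h(1), of a] that by (cases "a = x") simp_all
      qed
      \<comment> \<open>Everything in \<open>insert x M\<close> commutes with the nontrivial
        \<open>h\<close>, hence pairwise; a maximal abelian subgroup above this set properly
        contains \<open>M\<close>.\<close>
      have comm: "a \<otimes> b = b \<otimes> a" if "a \<in> insert x M" "b \<in> insert x M" for a b
        by (rule CSA_elementD(1)[OF e ch(1) ch(1) ch(2) ch(2)]) (rule that)+
      obtain N where N: "maximal_abelian_subgroup N G" "insert x M \<subseteq> N"
      proof (rule exists_maximal_abelian_subgroup)
        show "insert x M \<subseteq> carrier G" using x(1) Mc by blast
      qed (rule comm)
      have "abelian_subgroup N G" "M \<subseteq> N"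
        using N unfolding maximal_abelian_subgroup_def by auto
      then have "N = M" using M unfolding maximal_abelian_subgroup_def by blast
      then show False using N x by auto
    qed
    have one: "\<one> \<in> M" using subgroup.one_closed[OF sub(1)] .
    have "M \<inter> (\<lambda>h. inv x \<otimes> h \<otimes> x) ` M = {\<one>}" if x: "x \<in> carrier G - M" for x
    proof (intro equalityI subsetI)
      fix k assume "k \<in> M \<inter> (\<lambda>h. inv x \<otimes> h \<otimes> x) ` M"
      then obtain h where h: "h \<in> M" "k = inv x \<otimes> h \<otimes> x" "k \<in> M" by blast
      then have "h = \<one>" using mal[of x h] x by simp
      then show "k \<in> {\<one>}" using h x by simp
    next
      fix k assume "k \<in> {\<one>}"
      moreover have "\<one> = inv x \<otimes> \<one> \<otimes> x" using x by simp
      ultimately show "k \<in> M \<inter> (\<lambda>h. inv x \<otimes> h \<otimes> x) ` M"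
        using one by (simp add: image_eqI)
    qed
    then show "conjugately_separated M G"
      unfolding conjugately_separated_def conjugate_set by blast
  qed
qed

lemma no_order_two_iff:
  "no_order_two G \<longleftrightarrow> (\<forall>x \<in> carrier G. x \<otimes> x = \<one> \<longrightarrow> x = \<one>)"
proof -
  have "ord x = 2 \<longleftrightarrow> x \<otimes> x = \<one> \<and> x \<noteq> \<one>" if x: "x \<in> carrier G" for x
  proof
    assume 2: "ord x = 2"
    have "x [^] (2::nat) = \<one>" using pow_ord_eq_1[OF x] 2 by simp
    then show "x \<otimes> x = \<one> \<and> x \<noteq> \<one>" using x 2 ord_eq_1[OF x] by (auto simp: numeral_2_eq_2)
  next
    assume *: "x \<otimes> x = \<one> \<and> x \<noteq> \<one>"
    then have "ord x dvd 2" using pow_eq_id[OF x, of 2] x by (simp add: numeral_2_eq_2)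
    then have "ord x \<le> 2" "ord x \<noteq> 0" by (auto dest: dvd_imp_le intro!: Nat.gr0I)
    then have "ord x = 1 \<or> ord x = 2" by linarith
    then show "ord x = 2" using * ord_eq_1[OF x] by auto
  qed
  then show ?thesis by (auto simp: no_order_two_def)
qed

end

section \<open>Length functions with the four-point property\<close>

lemma eventually_constant:
  assumes "\<forall>\<^sub>F n in sequentially. f (Suc n) = f n"
  obtains c where "\<forall>\<^sub>F n in sequentially. f n = c"
proof -
  obtain N where N: "f (Suc n) = f n" if "n \<ge> N" for n
    using assms by (auto simp: eventually_sequentially)
  have "f n = f N" if "n \<ge> N" for n
    using that by (induction n rule: dec_induct) (use N in auto)
  then show thesis using that by (auto simp: eventually_sequentially)
qed

text \<open>\<open>L (x \<otimes> inv y)\<close> is a right-invariant pseudo-distance, and the last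
  axiom is 0-hyperbolicity, the condition met by distances in a tree. The triangle inequality is the
  case of two coinciding points.\<close>

locale tree_length = group G for G (structure) +
  fixes L :: "'a \<Rightarrow> int"
  assumes L_one: "L \<one> = 0"
    and L_inv: "x \<in> carrier G \<Longrightarrow> L (inv x) = L x"
    and four_point: "\<lbrakk>x \<in> carrier G; y \<in> carrier G; z \<in> carrier G; w \<in> carrier G\<rbrakk> \<Longrightarrow>
      L (x \<otimes> inv y) + L (z \<otimes> inv w)
        \<le> max (L (x \<otimes> inv z) + L (y \<otimes> inv w)) (L (x \<otimes> inv w) + L (y \<otimes> inv z))"
begin

lemma L_swap:
  assumes "x \<in> carrier G" "y \<in> carrier G"
  shows "L (x \<otimes> inv y) = L (y \<otimes> inv x)"
  using L_inv[of "x \<otimes> inv y"] assms by (simp add: inv_mult_group)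

lemma L_mult_le:
  assumes "x \<in> carrier G" "y \<in> carrier G"
  shows "L (x \<otimes> y) \<le> L x + L y"
  using four_point[of x "inv y" \<one> \<one>] assms L_one L_inv by simp

lemma L_nonneg: "x \<in> carrier G \<Longrightarrow> 0 \<le> L x"
  using L_mult_le[of x "inv x"] L_one L_inv by simp

lemma L_conj_le:
  assumes "p \<in> carrier G" "x \<in> carrier G"
  shows "L (inv p \<otimes> x \<otimes> p) \<le> L x + 2 * L p" "L x \<le> L (inv p \<otimes> x \<otimes> p) + 2 * L p"
proof -
  have *: "L (inv p \<otimes> x \<otimes> p) \<le> L x + 2 * L p" if "p \<in> carrier G" "x \<in> carrier G" for p x
    using that L_mult_le[of "inv p \<otimes> x" p] L_mult_le[of "inv p" x] L_inv[of p] by simp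
  show "L (inv p \<otimes> x \<otimes> p) \<le> L x + 2 * L p" by (rule *[OF assms])
  show "L x \<le> L (inv p \<otimes> x \<otimes> p) + 2 * L p"
    using *[of "inv p" "inv p \<otimes> x \<otimes> p"] assms L_inv[of p] by simp
qed

section \<open>Hyperbolic elements and their Busemann functions\<close>

definition hyperbolic :: "'a \<Rightarrow> bool" where
  "hyperbolic h \<longleftrightarrow> h \<in> carrier G \<and> filterlim (\<lambda>n. L (h [^] (n::nat))) at_top sequentially"

lemma hyperbolic_eventually:
  "hyperbolic h \<Longrightarrow> \<forall>\<^sub>F n in sequentially. K < L (h [^] (n::nat))"
  unfolding hyperbolic_def filterlim_at_top
  by (auto elim!: allE[of _ "K + 1"] eventually_mono)

text \<open>Of the three sums of opposite distances among four points the two largest agree. The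
  hypothesis makes the pairing of \<open>u\<close> with \<open>w\<close> strictly smaller than
  another, so the other two sums are equal.\<close>

lemma L_difference_eq:
  assumes "u \<in> carrier G" "w \<in> carrier G" "p \<in> carrier G" "q \<in> carrier G"
    and "L (u \<otimes> inv w) + L (p \<otimes> inv q) < L (u \<otimes> inv p) + L (w \<otimes> inv q)"
  shows "L (u \<otimes> inv p) - L (u \<otimes> inv q) = L (w \<otimes> inv p) - L (w \<otimes> inv q)"
  using four_point[of u p w q] four_point[of u q w p] assms
    L_swap[of p q] L_swap[of p w] L_swap[of q w] by simp

text \<open>As \<open>x\<close> commutes with \<open>h\<close>, the points
  \<open>h [^] n \<otimes> x\<close> and \<open>h [^] n\<close> stay at distance \<open>L x\<close>
  while going to infinity. From far away they see the points \<open>inv y\<close> and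
  \<open>\<one>\<close> with the same difference of distances.\<close>

lemma eventually_translate:
  assumes h: "hyperbolic h" and x: "x \<in> carrier G" "x \<otimes> h = h \<otimes> x" and y: "y \<in> carrier G"
  shows "\<forall>\<^sub>F n in sequentially.
    L (h [^] (n::nat) \<otimes> x \<otimes> y) - L (h [^] n \<otimes> x) = L (h [^] n \<otimes> y) - L (h [^] n)"
  using hyperbolic_eventually[OF h, of "L x + L y"]
proof eventually_elim
  case (elim n)
  have hc: "h \<in> carrier G" using h by (simp add: hyperbolic_def)
  have comm: "h [^] n \<otimes> x = x \<otimes> h [^] n" 
    by (rule group_commutes_pow) (use x hc in auto)
  have cl: "h [^] n \<otimes> x \<in> carrier G" "h [^] n \<in> carrier G" "inv y \<in> carrier G"
    using x y hc by auto
  have e: "h [^] n \<otimes> x \<otimes> inv (h [^] n) = x" using comm x hc by (simp add: m_assoc)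
  have i: "h [^] n \<otimes> x \<otimes> inv (inv y) = h [^] n \<otimes> x \<otimes> y" "h [^] n \<otimes> inv (inv y) = h [^] n \<otimes> y"
    "inv y \<otimes> inv \<one> = inv y" "h [^] n \<otimes> x \<otimes> inv \<one> = h [^] n \<otimes> x" "h [^] n \<otimes> inv \<one> = h [^] n"
    using x y hc by auto
  have "L x + L y < L (h [^] n \<otimes> x \<otimes> y) + L (h [^] n)"
    using elim L_nonneg[of "h [^] n \<otimes> x \<otimes> y"] x y hc by simp
  then show ?case
    using L_difference_eq[OF cl one_closed, unfolded i e] L_inv[OF y] by simp
qed

text \<open>The Busemann function of the end to which the powers of \<open>h\<close> converge.\<close>

definition shift :: "'a \<Rightarrow> 'a \<Rightarrow> int" where
  "shift h x = (SOME b. \<forall>\<^sub>F n in sequentially. L (h [^] (n::nat) \<otimes> x) = L (h [^] n) + b)"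

lemma shift_unique:
  assumes "\<forall>\<^sub>F n in sequentially. L (h [^] (n::nat) \<otimes> x) = L (h [^] n) + b"
  shows "shift h x = b"
proof -
  have "\<forall>\<^sub>F n in sequentially. L (h [^] (n::nat) \<otimes> x) = L (h [^] n) + shift h x"
    unfolding shift_def by (rule someI) (rule assms)
  then have "\<forall>\<^sub>F n::nat in sequentially. shift h x = b"
    using assms by eventually_elim simp
  then show ?thesis by simp
qed

text \<open>Translating by \<open>h\<close> itself shows that the difference of lengths is the same
  for \<open>n\<close> and \<open>Suc n\<close> from some point on, so the limit exists and is
  attained.\<close>

lemma eventually_shift:
  assumes h: "hyperbolic h" and x: "x \<in> carrier G"
  shows "\<forall>\<^sub>F n in sequentially. L (h [^] (n::nat) \<otimes> x) = L (h [^] n) + shift h x"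
proof -
  define f where "f n = L (h [^] (n::nat) \<otimes> x) - L (h [^] n)" for n
  have hc: "h \<in> carrier G" using h by (simp add: hyperbolic_def)
  have "\<forall>\<^sub>F n in sequentially. f (Suc n) = f n"
    using eventually_translate[OF h hc HOL.refl x] by (simp add: f_def)
  then obtain c where "\<forall>\<^sub>F n in sequentially. f n = c"
    using eventually_constant[of f] by blast
  then have "\<forall>\<^sub>F n in sequentially. L (h [^] (n::nat) \<otimes> x) = L (h [^] n) + c"
    by eventually_elim (simp add: f_def)
  then show ?thesis using shift_unique by simp
qed

lemma shift_mult:
  assumes h: "hyperbolic h" and x: "x \<in> carrier G" "x \<otimes> h = h \<otimes> x" and y: "y \<in> carrier G"
  shows "shift h (x \<otimes> y) = shift h x + shift h y"
proof (rule shift_unique)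
  have hc: "h \<in> carrier G" using h by (simp add: hyperbolic_def)
  show "\<forall>\<^sub>F n in sequentially.
      L (h [^] (n::nat) \<otimes> (x \<otimes> y)) = L (h [^] n) + (shift h x + shift h y)"
    using eventually_translate[OF assms] eventually_shift[OF h x(1)] eventually_shift[OF h y]
    by eventually_elim (use x y hc in \<open>simp add: m_assoc\<close>)
qed

lemma shift_one: "h \<in> carrier G \<Longrightarrow> shift h \<one> = 0"
  by (rule shift_unique) simp

lemma shift_inv:
  assumes "hyperbolic h" "x \<in> carrier G" "x \<otimes> h = h \<otimes> x"
  shows "shift h (inv x) = - shift h x"
  using shift_mult[OF assms, of "inv x"] assms shift_one[of h] by (simp add: hyperbolic_def)

lemma shift_pow:
  assumes "hyperbolic h" "x \<in> carrier G" "x \<otimes> h = h \<otimes> x"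
  shows "shift h (x [^] (n::nat)) = int n * shift h x"
proof (induction n)
  case (Suc n)
  have "x [^] Suc n = x \<otimes> x [^] n" using assms by (metis nat_pow_Suc2)
  then show ?case using Suc assms by (simp add: shift_mult algebra_simps)
qed (use assms in \<open>simp add: shift_one hyperbolic_def\<close>)

text \<open>Elements of zero shift preserve every horosphere, on which distances form an ultrametric.\<close>

lemma bounded_if_shift_0:
  assumes h: "hyperbolic h" and x: "x \<in> carrier G" "x \<otimes> h = h \<otimes> x" and 0: "shift h x = 0"
  shows "L (x [^] (n::nat)) \<le> L x"
proof (induction n)
  case 0
  then show ?case using L_nonneg[OF x(1)] by (simp add: L_one)
next
  case (Suc n)
  have hc: "h \<in> carrier G" using h by (simp add: hyperbolic_def)
  have "\<forall>\<^sub>F m in sequentially. L (h [^] (m::nat) \<otimes> inv x) = L (h [^] m)"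
    using eventually_shift[OF h, of "inv x"] shift_inv[OF h x] x 0 by simp
  moreover have "\<forall>\<^sub>F m in sequentially. L (h [^] (m::nat) \<otimes> x [^] n) = L (h [^] m)"
    using eventually_shift[OF h, of "x [^] n"] shift_pow[OF h x, of n] x 0 by simp
  ultimately have "\<forall>\<^sub>F m::nat in sequentially. L (x [^] Suc n) \<le> max (L x) (L (x [^] n))"
  proof eventually_elim
    case (elim m)
    have "x [^] Suc n = x \<otimes> x [^] n" using x by (metis nat_pow_Suc2)
    \<comment> \<open>The four points are \<open>x\<close>, the inverse of \<open>x [^] n\<close>,
      \<open>\<one>\<close> and \<open>h [^] m\<close>. For large \<open>m\<close> the first three
      are equally far from the last, and this common distance cancels.\<close>
    moreover have "L (x \<otimes> x [^] n) + L (h [^] m)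
        \<le> max (L x + L (h [^] m \<otimes> x [^] n)) (L (h [^] m \<otimes> inv x) + L (x [^] n))"
      using four_point[of x "inv (x [^] n)" \<one> "h [^] m"] x hc
        L_swap[of x "h [^] m"] L_swap[of \<one> "h [^] m"] L_swap[of "inv (x [^] n)" "h [^] m"]
        L_inv[of "x [^] n"]
      by (simp add: max.commute algebra_simps)
    ultimately show ?case using elim by (simp add: max_def split: if_splits)
  qed
  then have "L (x [^] Suc n) \<le> max (L x) (L (x [^] n))" by simp
  with Suc show ?case by simp
qed

text \<open>Otherwise the lengths of the powers would eventually be nonincreasing, hence
  bounded.\<close>

lemma shift_self_pos:
  assumes h: "hyperbolic h"
  shows "shift h h > 0"
proof (rule ccontr)
  assume neg: "\<not> shift h h > 0"
  have hc: "h \<in> carrier G" using h by (simp add: hyperbolic_def)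
  have "\<forall>\<^sub>F n in sequentially. L (h [^] Suc n) \<le> L (h [^] (n::nat))"
    using eventually_shift[OF h hc] by eventually_elim (use neg in simp)
  then obtain N where N: "L (h [^] Suc n) \<le> L (h [^] (n::nat))" if "n \<ge> N" for n
    by (auto simp: eventually_sequentially)
  have "L (h [^] n) \<le> L (h [^] N)" if "n \<ge> N" for n
    using that by (induction n rule: dec_induct) (use N in force)+
  then have "\<forall>\<^sub>F n in sequentially. L (h [^] (n::nat)) \<le> L (h [^] N)"
    by (auto simp: eventually_sequentially)
  with hyperbolic_eventually[OF h, of "L (h [^] N)"]
  have "\<forall>\<^sub>F n::nat in sequentially. False" by eventually_elim simp
  then show False by simp
qed

text \<open>So \<open>shift h h\<close> is the translation length of \<open>h\<close>.\<close>

lemma L_pow_affine: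
  assumes h: "hyperbolic h"
  obtains K where "\<forall>\<^sub>F n in sequentially. L (h [^] (n::nat)) = int n * shift h h + K"
proof -
  have hc: "h \<in> carrier G" using h by (simp add: hyperbolic_def)
  define f where "f n = L (h [^] (n::nat)) - int n * shift h h" for n
  have "\<forall>\<^sub>F n in sequentially. f (Suc n) = f n"
    using eventually_shift[OF h hc] by eventually_elim (simp add: f_def algebra_simps)
  then obtain c where "\<forall>\<^sub>F n in sequentially. f n = c"
    using eventually_constant[of f] by blast
  then have "\<forall>\<^sub>F n in sequentially. L (h [^] (n::nat)) = int n * shift h h + c"
    by eventually_elim (simp add: f_def)
  then show thesis by (rule that)
qed

lemma L_pow_bound_eq:
  assumes h: "hyperbolic h" and b: "\<And>n::nat. \<bar>L (h [^] (p * n)) - L (h [^] (q * n))\<bar> \<le> B"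
    and p: "p > 0" "q > 0"
  shows "p = (q::nat)"
proof (rule ccontr)
  assume ne: "p \<noteq> q"
  obtain K where "\<forall>\<^sub>F n in sequentially. L (h [^] (n::nat)) = int n * shift h h + K"
    using L_pow_affine[OF h] .
  then obtain N where N: "L (h [^] n) = int n * shift h h + K" if "n \<ge> N" for n
    by (auto simp: eventually_sequentially)
  \<comment> \<open>As \<open>p\<close> and \<open>q\<close> are positive, both multiples of
    \<open>n\<close> are in the affine range, where the two lengths differ by at least
    \<open>n\<close>, which exceeds \<open>B\<close>.\<close>
  define n where "n = N + nat (B + 1)"
  have "N \<le> n" "n \<le> p * n" "n \<le> q * n" using p by (auto simp: n_def)
  then have "L (h [^] (p * n)) = int (p * n) * shift h h + K"
    "L (h [^] (q * n)) = int (q * n) * shift h h + K"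
    using N[of "p * n"] N[of "q * n"] by linarith+
  then have "\<bar>(int p - int q) * (int n * shift h h)\<bar> \<le> B"
    using b[of n] by (simp add: algebra_simps)
  moreover have "\<bar>(int p - int q) * (int n * shift h h)\<bar> \<ge> 1 * (int n * 1)"
    unfolding abs_mult using ne shift_self_pos[OF h]
    by (intro mult_mono) auto
  moreover have "B \<ge> 0" using b[of 0] by simp
  ultimately show False by (simp add: n_def)
qed

section \<open>The centralizer of a hyperbolic element\<close>

context
  fixes h
  assumes h: "hyperbolic h"
    and rigid: "\<And>z. z \<in> carrier G \<Longrightarrow> z \<otimes> h = h \<otimes> z \<Longrightarrow> \<not> hyperbolic z \<Longrightarrow> z = \<one>"
begin

lemma h_closed: "h \<in> carrier G"
  using h by (simp add: hyperbolic_def)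

text \<open>Vanishing shift bounds the lengths of the powers, so \<open>x\<close> is not hyperbolic
  and \<open>rigid\<close> applies. Thus the shift embeds the centralizer of \<open>h\<close> into
  the integers.\<close>

lemma trivial_if_shift_0:
  assumes x: "x \<in> carrier G" "x \<otimes> h = h \<otimes> x" and 0: "shift h x = 0"
  shows "x = \<one>"
proof (rule rigid[OF x], rule notI)
  assume "hyperbolic x"
  from hyperbolic_eventually[OF this, of "L x"]
  show False using bounded_if_shift_0[OF h x 0] by (auto dest!: eventually_happens simp: not_le[symmetric])
qed

lemma eq_if_shift_eq:
  assumes x: "x \<in> carrier G" "x \<otimes> h = h \<otimes> x" and y: "y \<in> carrier G" "y \<otimes> h = h \<otimes> y"
    and eq: "shift h x = shift h y"
  shows "x = y"
proof -
  have iy: "inv y \<otimes> h = h \<otimes> inv y" using y h_closed by (intro inv_commute)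
  then have "x \<otimes> inv y = \<one>"
    using x y h_closed eq
    by (intro trivial_if_shift_0 mult_commute) (simp_all add: shift_mult[OF h] shift_inv[OF h])
  then show ?thesis using x y by (metis inv_equality inv_closed inv_inv)
qed

lemma centralizer_abelian:
  assumes x: "x \<in> carrier G" "x \<otimes> h = h \<otimes> x" and y: "y \<in> carrier G" "y \<otimes> h = h \<otimes> y"
  shows "x \<otimes> y = y \<otimes> x"
proof (rule eq_if_shift_eq)
  show "x \<otimes> y \<otimes> h = h \<otimes> (x \<otimes> y)" "y \<otimes> x \<otimes> h = h \<otimes> (y \<otimes> x)"
    using x y h_closed by (blast intro: mult_commute)+
qed (use x y in \<open>simp_all add: shift_mult[OF h]\<close>)

text \<open>Among integers, \<open>shift h h\<close> times \<open>shift h k\<close> can be read as a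
  multiple of either shift, and injectivity of the shift turns this into an equality of powers.
  Taking \<open>g\<close> to be \<open>h\<close> or its inverse absorbs the sign, so that the
  exponents are natural numbers.\<close>

lemma common_power:
  assumes k: "k \<in> carrier G" "k \<otimes> h = h \<otimes> k"
  obtains g where "g = h \<or> g = inv h" "shift h k = \<bar>shift h k\<bar> * sgn (shift h g)"
    "k [^] nat (shift h h) = g [^] nat \<bar>shift h k\<bar>"
proof
  define g where "g = (if shift h k \<ge> 0 then h else inv h)"
  have pos: "shift h h > 0" by (rule shift_self_pos[OF h])
  have ih: "shift h (inv h) = - shift h h" using shift_inv[OF h h_closed] by simp
  show gh: "g = h \<or> g = inv h" by (auto simp: g_def)
  show "shift h k = \<bar>shift h k\<bar> * sgn (shift h g)" using pos by (auto simp: g_def ih)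
  have g: "g \<in> carrier G" "g \<otimes> h = h \<otimes> g" using gh h_closed by auto
  show "k [^] nat (shift h h) = g [^] nat \<bar>shift h k\<bar>"
  proof (rule eq_if_shift_eq)
    show "k [^] n \<otimes> h = h \<otimes> k [^] n" "g [^] n \<otimes> h = h \<otimes> g [^] n" for n :: nat
      using group_commutes_pow k g h_closed by blast+
    show "shift h (k [^] nat (shift h h)) = shift h (g [^] nat \<bar>shift h k\<bar>)"
      unfolding shift_pow[OF h k] shift_pow[OF h g] using pos by (auto simp: g_def ih)
  qed (use k g in simp_all)
qed

text \<open>Powers of conjugate elements have lengths at bounded distance. As \<open>k [^] p\<close>
  equals \<open>g [^] q\<close>, the lengths of \<open>h [^] (p * n)\<close> and
  \<open>h [^] (q * n)\<close> stay close, which forces \<open>p = q\<close>; then \<open>k\<close>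
  and \<open>g\<close> have equal shift.\<close>

lemma conj_in_centralizer:
  assumes x: "x \<in> carrier G" and k: "k = inv x \<otimes> h \<otimes> x" "k \<otimes> h = h \<otimes> k"
  shows "k = h \<or> k = inv h"
proof -
  have kc: "k \<in> carrier G" using x h_closed k by simp
  define p q where "p = nat (shift h h)" and "q = nat \<bar>shift h k\<bar>"
  obtain g where gh: "g = h \<or> g = inv h" and sk: "shift h k = \<bar>shift h k\<bar> * sgn (shift h g)"
    and kg: "k [^] p = g [^] q"
    using common_power[OF kc k(2)] unfolding p_def q_def .
  have pos: "shift h h > 0" by (rule shift_self_pos[OF h])
  have g: "g \<in> carrier G" "g \<otimes> h = h \<otimes> g" using gh h_closed by auto
  have "L (g [^] n) = L (h [^] n)" for n :: nat
    using h_closed gh L_inv[of "h [^] n"] by (auto simp: nat_pow_inv)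
  moreover have "k [^] (p * n) = g [^] (q * n)" for n
    using nat_pow_pow[OF kc, of p n] nat_pow_pow[OF g(1), of q n] kg by simp
  ultimately have Lk: "L (k [^] (p * n)) = L (h [^] (q * n))" for n by simp
  have b: "\<bar>L (h [^] (p * n)) - L (h [^] (q * n))\<bar> \<le> 2 * L x" for n
    using L_conj_le[of x "h [^] (p * n)"] x h_closed Lk[of n] by (simp add: k(1) conj_pow)
  have p0: "p > 0" using pos by (simp add: p_def)
  \<comment> \<open>For \<open>q = 0\<close> the lengths of the powers \<open>h [^] (p * n)\<close>
    would be bounded by \<open>2 * L x\<close>.\<close>
  have "q > 0"
  proof (rule ccontr)
    assume "\<not> q > 0"
    then have le: "L (h [^] (p * n)) \<le> 2 * L x" for n using b[of n] L_one by simp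
    obtain N where N: "2 * L x < L (h [^] n)" if "n \<ge> N" for n :: nat
      using hyperbolic_eventually[OF h, of "2 * L x"] by (auto simp: eventually_sequentially)
    have "p * N \<ge> N" using p0 by simp
    with N[of "p * N"] le[of N] show False by simp
  qed
  with p0 have "p = q" using L_pow_bound_eq[OF h b] by simp
  then have "shift h k = shift h g"
    using pos sk gh shift_inv[OF h h_closed] by (auto simp: p_def q_def)
  then have "k = g" by (rule eq_if_shift_eq[OF kc k(2) g])
  then show ?thesis using gh by simp
qed

lemma CSA_element_hyperbolic:
  assumes two: "no_order_two G"
  shows "CSA_element G h"
  unfolding CSA_element_def
proof (intro conjI ballI impI)
  fix x y assume xy: "x \<in> carrier G" "y \<in> carrier G" "x \<otimes> h = h \<otimes> x" "y \<otimes> h = h \<otimes> y"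
  show "x \<otimes> y = y \<otimes> x" by (rule centralizer_abelian[OF xy(1,3,2,4)])
next
  fix x assume x: "x \<in> carrier G" "(inv x \<otimes> h \<otimes> x) \<otimes> h = h \<otimes> (inv x \<otimes> h \<otimes> x)"
  from conj_in_centralizer[OF x(1) HOL.refl x(2)] show "x \<otimes> h = h \<otimes> x"
  proof
    assume "inv x \<otimes> h \<otimes> x = h"
    then show ?thesis using conj_fixes_iff[OF x(1) h_closed] by simp
  next
    \<comment> \<open>Inverting twice, \<open>x \<otimes> x\<close> commutes with \<open>h\<close>,
      so one of its powers is a power of \<open>g\<close>. Conjugation by \<open>x\<close> both
      inverts and fixes this common power, which then has trivial square and is trivial. Hence
      \<open>x \<otimes> x\<close> has shift zero, and both it and \<open>x\<close> are
      trivial.\<close>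
    assume i: "inv x \<otimes> h \<otimes> x = inv h"
    have i': "inv x \<otimes> inv h \<otimes> x = h"
      using conj_inv[OF x(1) h_closed] h_closed by (simp only: i inv_inv)
    have "inv (x \<otimes> x) \<otimes> h \<otimes> (x \<otimes> x) = h"
      using conj_conj[OF x(1) x(1) h_closed] by (simp only: i i')
    then have xx: "x \<otimes> x \<otimes> h = h \<otimes> (x \<otimes> x)"
      using conj_fixes_iff[of "x \<otimes> x" h] x(1) h_closed by simp
    define p q where "p = nat (shift h h)" and "q = nat \<bar>shift h (x \<otimes> x)\<bar>"
    obtain g where gh: "g = h \<or> g = inv h" and xg: "(x \<otimes> x) [^] p = g [^] q"
      using common_power[OF _ xx] x(1) unfolding p_def q_def by blast
    have gc: "g \<in> carrier G" using gh h_closed by auto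
    have "inv x \<otimes> g \<otimes> x = inv g"
      using gh i i' h_closed by (elim disjE) simp_all
    then have "inv x \<otimes> g [^] q \<otimes> x = inv (g [^] q)"
      using conj_pow[OF x(1) gc, of q] nat_pow_inv[OF gc, of q] by simp
    moreover have "inv x \<otimes> (x \<otimes> x) \<otimes> x = x \<otimes> x"
      using x(1) by (simp add: m_assoc[symmetric])
    then have "inv x \<otimes> (x \<otimes> x) [^] p \<otimes> x = (x \<otimes> x) [^] p"
      using conj_pow[of x "x \<otimes> x" p] x(1) by simp
    ultimately have "inv (g [^] q) = g [^] q" unfolding xg by metis
    then have "g [^] q \<otimes> g [^] q = \<one>" using l_inv[OF nat_pow_closed[OF gc, of q]] by metis
    then have "(x \<otimes> x) [^] p = \<one>" using two gc unfolding no_order_two_iff xg by blast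
    then have "int p * shift h (x \<otimes> x) = 0"
      using shift_pow[OF h _ xx, of p] shift_one[OF h_closed] x(1) by simp
    moreover have "p > 0" using shift_self_pos[OF h] by (simp add: p_def)
    ultimately have "shift h (x \<otimes> x) = 0" by simp
    then have "x \<otimes> x = \<one>" by (rule trivial_if_shift_0[OF m_closed[OF x(1,1)] xx])
    then have "x = \<one>" using two x(1) unfolding no_order_two_iff by blast
    then show ?thesis using h_closed by simp
  qed
qed

end
end

section \<open>Actions on normal forms\<close>

text \<open>The choice depends only on the right coset of \<open>g\<close>. Reserving the identity
  for the coset \<open>D\<close> itself lets membership in \<open>D\<close> be read off the
  representative.\<close>

definition coset_rep :: "('a, 'm) monoid_scheme \<Rightarrow> 'a set \<Rightarrow> 'a \<Rightarrow> 'a" where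
  "coset_rep G D g = (if g \<in> D then \<one>\<^bsub>G\<^esub> else SOME x. x \<in> D #>\<^bsub>G\<^esub> g)"

context group
begin

context
  fixes D
  assumes D: "subgroup D G"
begin

lemma coset_rep_in_coset:
  assumes "g \<in> carrier G"
  shows "coset_rep G D g \<in> D #> g"
proof (cases "g \<in> D")
  case True
  then show ?thesis
    using coset_join2[OF assms D True] subgroup.one_closed[OF D] by (simp add: coset_rep_def)
next
  case False
  have "(SOME x. x \<in> D #> g) \<in> D #> g" by (rule someI) (rule rcos_self[OF assms D])
  then show ?thesis using False by (simp add: coset_rep_def)
qed

lemma coset_rep_closed: "g \<in> carrier G \<Longrightarrow> coset_rep G D g \<in> carrier G"
  using coset_rep_in_coset r_coset_subset_G[OF subgroup.subset[OF D]] by blast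

lemma coset_rep_mult:
  assumes "d \<in> D" "g \<in> carrier G"
  shows "coset_rep G D (d \<otimes> g) = coset_rep G D g"
proof -
  have d: "d \<in> carrier G" using assms subgroup.mem_carrier[OF D] by blast
  have "d \<otimes> g \<in> D \<longleftrightarrow> g \<in> D"
  proof
    assume "d \<otimes> g \<in> D"
    then have "inv d \<otimes> (d \<otimes> g) \<in> D"
      by (rule subgroup.m_closed[OF D subgroup.m_inv_closed[OF D assms(1)]])
    then show "g \<in> D" using d assms(2) by (simp add: m_assoc[symmetric])
  qed (rule subgroup.m_closed[OF D assms(1)])
  moreover have "D #> (d \<otimes> g) = D #> g"
    using coset_mult_assoc[OF subgroup.subset[OF D] d assms(2)] coset_join2[OF d D assms(1)]
    by simp
  ultimately show ?thesis by (simp add: coset_rep_def)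
qed

lemma coset_rep_obtain:
  assumes "g \<in> carrier G"
  obtains d where "d \<in> D" "coset_rep G D g = d \<otimes> g"
  using coset_rep_in_coset[OF assms] by (auto simp: r_coset_def)

lemma coset_rep_idem: "g \<in> carrier G \<Longrightarrow> coset_rep G D (coset_rep G D g) = coset_rep G D g"
  by (rule coset_rep_obtain, assumption) (simp add: coset_rep_mult)

lemma mult_inv_coset_rep:
  assumes "g \<in> carrier G"
  shows "g \<otimes> inv (coset_rep G D g) \<in> D"
proof -
  obtain d where d: "d \<in> D" "coset_rep G D g = d \<otimes> g" using coset_rep_obtain[OF assms] .
  then have "g \<otimes> inv (coset_rep G D g) = inv d"
    using assms subgroup.mem_carrier[OF D d(1)] by (simp add: inv_mult_group m_assoc[symmetric])
  then show ?thesis using subgroup.m_inv_closed[OF D d(1)] by simp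
qed

lemma coset_rep_eq_one_iff:
  assumes "g \<in> carrier G"
  shows "coset_rep G D g = \<one> \<longleftrightarrow> g \<in> D"
  using mult_inv_coset_rep[OF assms] assms by (auto simp: coset_rep_def)

lemma coset_rep_eq:
  assumes "g \<in> carrier G" "h \<in> carrier G" "g \<otimes> inv h \<in> D"
  shows "coset_rep G D g = coset_rep G D h"
  using coset_rep_mult[OF assms(3,2)] assms by (simp add: m_assoc)

end
end

text \<open>
  One factor \<open>H\<close> of an amalgam over \<open>K\<close> acts on the normal forms \<open>(c, ts)\<close>, which stand for the
  products \<open>c \<otimes> t\<^sub>1 \<otimes> \<dots> \<otimes> t\<^sub>n\<close> of an element of \<open>K\<close> with alternating coset representatives.
  \<open>N\<^sub>0\<close> consists of the lists that do not start with a representative in \<open>H\<close>. Absorbing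
  the first representative into \<open>c\<close> identifies normal forms with \<open>H \<times> N\<^sub>0\<close>, on which \<open>H\<close> acts
  by translation.
\<close>

locale factor_action = group H + K: group K
  for H :: "('h, 'm) monoid_scheme" (structure) and K :: "('c, 'n) monoid_scheme" +
  fixes \<iota> :: "'c \<Rightarrow> 'h" and e :: "'h \<Rightarrow> 'x" and N N\<^sub>0 :: "'x list set"
  assumes iota: "\<iota> \<in> mon K H" and inj_e: "inj e"
    and N_eq: "N = N\<^sub>0 \<union> {e t # r | t r. r \<in> N\<^sub>0 \<and> t \<in> carrier H - \<iota> ` carrier K \<and>
      coset_rep H (\<iota> ` carrier K) t = t}"
    and N0_hd: "e t # r \<notin> N\<^sub>0"
begin

abbreviation "D \<equiv> \<iota> ` carrier K"
abbreviation "rep \<equiv> coset_rep H D"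
abbreviation "\<Omega> \<equiv> carrier K \<times> N"

definition iota_inv :: "'h \<Rightarrow> 'c" where "iota_inv = the_inv_into (carrier K) \<iota>"

sublocale iota: group_hom K H \<iota>
  using iota by unfold_locales (simp add: mon_def)

lemma inj_iota: "inj_on \<iota> (carrier K)"
  using iota by (simp add: mon_def)

lemma subgroup_D: "subgroup D H"
  using iota.img_is_subgroup by simp

lemma iota_inv_iota [simp]: "c \<in> carrier K \<Longrightarrow> iota_inv (\<iota> c) = c"
  by (simp add: iota_inv_def the_inv_into_f_f[OF inj_iota])

lemma iota_iota_inv [simp]: "d \<in> D \<Longrightarrow> \<iota> (iota_inv d) = d"
  by (simp add: iota_inv_def f_the_inv_into_f[OF inj_iota])

lemma iota_inv_closed [simp]: "d \<in> D \<Longrightarrow> iota_inv d \<in> carrier K"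
  by auto

definition split_nf :: "'c \<times> 'x list \<Rightarrow> 'h \<times> 'x list" where
  "split_nf \<omega> = (if snd \<omega> \<in> N\<^sub>0 then (\<iota> (fst \<omega>), snd \<omega>)
     else (\<iota> (fst \<omega>) \<otimes> the_inv e (hd (snd \<omega>)), tl (snd \<omega>)))"

text \<open>This is the factorization of \<open>g\<close> into an element of \<open>D\<close> and
  its coset representative. If \<open>g\<close> lies in \<open>D\<close>, the representative is the
  identity and contributes no letter.\<close>

definition join_nf :: "'h \<times> 'x list \<Rightarrow> 'c \<times> 'x list" where
  "join_nf p = (iota_inv (fst p \<otimes> inv (rep (fst p))),
     if fst p \<in> D then snd p else e (rep (fst p)) # snd p)"

definition act :: "'h \<Rightarrow> 'c \<times> 'x list \<Rightarrow> 'c \<times> 'x list" where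
  "act h \<omega> = join_nf (h \<otimes> fst (split_nf \<omega>), snd (split_nf \<omega>))"

lemma split_join:
  assumes "g \<in> carrier H" "r \<in> N\<^sub>0"
  shows "split_nf (join_nf (g, r)) = (g, r)"
proof (cases "g \<in> D")
  case True
  then show ?thesis using assms coset_rep_eq_one_iff[OF subgroup_D assms(1)]
    by (simp add: split_nf_def join_nf_def)
next
  case False
  then show ?thesis
    using assms mult_inv_coset_rep[OF subgroup_D assms(1)] coset_rep_closed[OF subgroup_D assms(1)]
    by (simp add: split_nf_def join_nf_def N0_hd the_inv_f_f[OF inj_e] m_assoc)
qed

lemma join_closed:
  assumes "g \<in> carrier H" "r \<in> N\<^sub>0"
  shows "join_nf (g, r) \<in> \<Omega>"
  using assms mult_inv_coset_rep[OF subgroup_D assms(1)] coset_rep_closed[OF subgroup_D assms(1)]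
    coset_rep_idem[OF subgroup_D assms(1)] coset_rep_eq_one_iff[OF subgroup_D assms(1)]
    coset_rep_eq_one_iff[OF subgroup_D, of "rep g"]
  unfolding N_eq by (auto simp: join_nf_def simp del: iota.img_is_subgroup)

lemma N_cases:
  assumes "ts \<in> N"
  obtains "ts \<in> N\<^sub>0"
    | t r where "ts = e t # r" "r \<in> N\<^sub>0" "t \<in> carrier H" "t \<notin> D" "rep t = t" "ts \<notin> N\<^sub>0"
  using assms N0_hd unfolding N_eq by blast

lemma split_closed:
  assumes "c \<in> carrier K" "ts \<in> N"
  shows "split_nf (c, ts) \<in> carrier H \<times> N\<^sub>0"
  using assms(2) by (rule N_cases) (use assms(1) in \<open>auto simp: split_nf_def the_inv_f_f[OF inj_e]\<close>)

text \<open>Multiplying by an element of \<open>D\<close> does not change the coset representative.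
  As the result does not mention \<open>H\<close>, the actions of both factors agree on
  \<open>K\<close>, which allows them to be glued.\<close>

lemma act_iota:
  assumes "c \<in> carrier K" "c' \<in> carrier K" "ts \<in> N"
  shows "act (\<iota> c) (c', ts) = (c \<otimes>\<^bsub>K\<^esub> c', ts)"
  using assms(3)
proof (cases rule: N_cases)
  case 1
  have "\<iota> c \<otimes> \<iota> c' \<in> D" using assms by (auto simp flip: iota.hom_mult)
  moreover from this have "rep (\<iota> c \<otimes> \<iota> c') = \<one>"
    using coset_rep_eq_one_iff[OF subgroup_D] assms by simp
  ultimately show ?thesis using assms 1 
    by (simp add: act_def split_nf_def join_nf_def flip: iota.hom_mult)
next
  case (2 t r)
  have cc: "\<iota> (c \<otimes>\<^bsub>K\<^esub> c') \<in> D" using assms by blast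
  have m: "\<iota> c \<otimes> (\<iota> c' \<otimes> t) = \<iota> (c \<otimes>\<^bsub>K\<^esub> c') \<otimes> t" using assms 2 by (simp add: m_assoc)
  have r: "rep (\<iota> (c \<otimes>\<^bsub>K\<^esub> c') \<otimes> t) = t"
    using coset_rep_mult[OF subgroup_D cc 2(3)] 2 by simp
  have "\<iota> (c \<otimes>\<^bsub>K\<^esub> c') \<otimes> t \<notin> D"
    using coset_rep_eq_one_iff[OF subgroup_D, of "\<iota> (c \<otimes>\<^bsub>K\<^esub> c') \<otimes> t"]
      coset_rep_eq_one_iff[OF subgroup_D, of t] assms 2 r by auto
  then show ?thesis using assms 2
    by (simp add: act_def split_nf_def join_nf_def the_inv_f_f[OF inj_e] m r
        m_assoc del: iota.hom_mult)
qed

lemma join_split: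
  assumes "c \<in> carrier K" "ts \<in> N"
  shows "join_nf (split_nf (c, ts)) = (c, ts)"
proof -
  \<comment> \<open>Acting by the identity is splitting followed by joining.\<close>
  have "act (\<iota> \<one>\<^bsub>K\<^esub>) (c, ts) = (c, ts)" using act_iota[OF K.one_closed assms] assms by simp
  then show ?thesis using split_closed[OF assms] by (auto simp: act_def)
qed

lemma act_closed: "x \<in> carrier H \<Longrightarrow> \<omega> \<in> \<Omega> \<Longrightarrow> act x \<omega> \<in> \<Omega>"
  using split_closed[of "fst \<omega>" "snd \<omega>"] unfolding act_def
  by (intro join_closed) (auto simp: mem_Times_iff)

lemma act_mult:
  assumes "x \<in> carrier H" "y \<in> carrier H" "\<omega> \<in> \<Omega>"
  shows "act (x \<otimes> y) \<omega> = act x (act y \<omega>)"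
proof -
  obtain c ts where "\<omega> = (c, ts)" "c \<in> carrier K" "ts \<in> N" using assms by auto
  with assms split_closed[of c ts] show ?thesis
    by (auto simp: act_def split_join m_assoc)
qed

lemma act_one:
  assumes "\<omega> \<in> \<Omega>"
  shows "act \<one> \<omega> = \<omega>"
proof -
  obtain c ts where "\<omega> = (c, ts)" "c \<in> carrier K" "ts \<in> N" using assms by auto
  with split_closed[of c ts] join_split[of c ts] show ?thesis by (auto simp: act_def)
qed

text \<open>The list does not begin in \<open>H\<close>, so nothing is absorbed, and
  \<open>x \<otimes> \<iota> c\<close> stays outside \<open>D\<close>: exactly one letter is
  prepended. This is what makes syllables of reduced words countable.\<close>

lemma act_proper:
  assumes "x \<in> carrier H" "x \<notin> D" "c \<in> carrier K" "ts \<in> N\<^sub>0"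
  shows "\<exists>t. snd (act x (c, ts)) = e t # ts"
proof -
  have ic: "\<iota> c \<in> D" using assms by blast
  have "x \<otimes> \<iota> c \<notin> D"
  proof
    assume "x \<otimes> \<iota> c \<in> D"
    then have "x \<otimes> \<iota> c \<otimes> inv (\<iota> c) \<in> D"
      by (rule subgroup.m_closed[OF subgroup_D _ subgroup.m_inv_closed[OF subgroup_D ic]])
    moreover have "x \<otimes> \<iota> c \<otimes> inv (\<iota> c) = x" using assms by (simp add: m_assoc)
    ultimately show False using assms by simp
  qed
  then show ?thesis using assms by (auto simp: act_def split_nf_def join_nf_def)
qed

text \<open>The restriction to \<open>\<Omega>\<close> is there because elements of
  \<open>BijGroup\<close> are extensional functions.\<close>

lemma act_hom: "(\<lambda>x. restrict (act x) \<Omega>) \<in> hom H (BijGroup \<Omega>)"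
proof -
  have Bij: "restrict (act x) \<Omega> \<in> Bij \<Omega>" if x: "x \<in> carrier H" for x
  proof -
    have "bij_betw (act x) \<Omega> \<Omega>"
    proof (rule bij_betwI)
      show "act x \<in> \<Omega> \<rightarrow> \<Omega>" "act (inv x) \<in> \<Omega> \<rightarrow> \<Omega>" using act_closed x by blast+
      show "act (inv x) (act x \<omega>) = \<omega>" "act x (act (inv x) \<omega>) = \<omega>" if "\<omega> \<in> \<Omega>" for \<omega>
        using x that act_mult[of "inv x" x] act_mult[of x "inv x"] act_one by simp_all
    qed
    then show ?thesis by (simp add: Bij_def)
  qed
  show ?thesis
  proof (rule homI)
    fix x y assume xy: "x \<in> carrier H" "y \<in> carrier H"
    have "restrict (act (x \<otimes> y)) \<Omega> = compose \<Omega> (restrict (act x) \<Omega>) (restrict (act y) \<Omega>)"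
    proof (rule ext)
      fix \<omega>
      show "restrict (act (x \<otimes> y)) \<Omega> \<omega> = compose \<Omega> (restrict (act x) \<Omega>) (restrict (act y) \<Omega>) \<omega>"
        using act_mult[OF xy, of \<omega>] act_closed[OF xy(2), of \<omega>]
        by (cases "\<omega> \<in> \<Omega>") (simp_all add: compose_def)
    qed
    then show "restrict (act (x \<otimes> y)) \<Omega> =
        restrict (act x) \<Omega> \<otimes>\<^bsub>BijGroup \<Omega>\<^esub> restrict (act y) \<Omega>"
      using Bij xy by (simp add: BijGroup_def)
  qed (use Bij in \<open>simp add: BijGroup_def\<close>)
qed

end

section \<open>Normal forms in amalgamated products\<close>

locale amalgam_mon = amalgam G A C \<phi>
  for G :: "('a, 'm) monoid_scheme" and A :: "('b, 'n) monoid_scheme"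
    and C :: "'a set" and \<phi> :: "'a \<Rightarrow> 'b" +
  assumes subgroup_C: "subgroup C G" and phi_mon: "\<phi> \<in> mon (G\<lparr>carrier := C\<rparr>) A"
begin

sublocale P: group P by (rule group_P)

definition proper :: "'a + 'b \<Rightarrow> bool" where
  "proper x \<longleftrightarrow> (case x of Inl g \<Rightarrow> g \<in> carrier G - C | Inr a \<Rightarrow> a \<in> carrier A - \<phi> ` C)"

definition reduced :: "('a + 'b) list \<Rightarrow> bool" where
  "reduced u \<longleftrightarrow> (\<forall>x \<in> set u. proper x) \<and> successively (\<lambda>x y. isl x \<noteq> isl y) u"

definition is_rep :: "'a + 'b \<Rightarrow> bool" where
  "is_rep x \<longleftrightarrow>
     (case x of Inl g \<Rightarrow> coset_rep G C g = g | Inr a \<Rightarrow> coset_rep A (\<phi> ` C) a = a)"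

definition normal_word :: "('a + 'b) list \<Rightarrow> bool" where
  "normal_word ts \<longleftrightarrow> reduced ts \<and> (\<forall>x \<in> set ts. is_rep x)"

lemma proper_simps [simp]:
  "proper (Inl g) \<longleftrightarrow> g \<in> carrier G \<and> g \<notin> C"
  "proper (Inr a) \<longleftrightarrow> a \<in> carrier A \<and> a \<notin> \<phi> ` C"
  by (auto simp: proper_def)

lemma is_rep_simps [simp]:
  "is_rep (Inl g) \<longleftrightarrow> coset_rep G C g = g"
  "is_rep (Inr a) \<longleftrightarrow> coset_rep A (\<phi> ` C) a = a"
  by (auto simp: is_rep_def)

lemma reduced_Nil [simp]: "reduced []"
  by (simp add: reduced_def)

lemma reduced_Cons:
  "reduced (x # u) \<longleftrightarrow> proper x \<and> reduced u \<and> (u = [] \<or> isl x \<noteq> isl (hd u))"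
  by (auto simp: reduced_def successively_Cons)

lemma reduced_append:
  "reduced (u @ w) \<longleftrightarrow>
     reduced u \<and> reduced w \<and> (u = [] \<or> w = [] \<or> isl (last u) \<noteq> isl (hd w))"
  by (auto simp: reduced_def successively_append_iff)

lemma normal_word_Nil [simp]: "normal_word []"
  by (simp add: normal_word_def)

lemma normal_word_Cons:
  "normal_word (x # u) \<longleftrightarrow> proper x \<and> is_rep x \<and> normal_word u \<and> (u = [] \<or> isl x \<noteq> isl (hd u))"
  by (auto simp: normal_word_def reduced_Cons)

lemma proper_letter: "proper x \<Longrightarrow> x \<in> carrier G <+> carrier A"
  by (cases x) auto

lemma reduced_words: "reduced u \<Longrightarrow> u \<in> words G A"
  by (induction u rule: list.induct) (auto simp: reduced_Cons dest: proper_letter)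

lemma normal_word_words: "normal_word u \<Longrightarrow> u \<in> words G A"
  by (simp add: normal_word_def reduced_words)

sublocale left: factor_action G "G\<lparr>carrier := C\<rparr>" "\<lambda>c. c" Inl "Collect normal_word"
  "{ts. normal_word ts \<and> (ts = [] \<or> \<not> isl (hd ts))}"
proof (intro factor_action.intro factor_action_axioms.intro)
  show "group (G\<lparr>carrier := C\<rparr>)" using G.subgroup_imp_group[OF subgroup_C] .
  show "(\<lambda>c. c) \<in> mon (G\<lparr>carrier := C\<rparr>) G"
    using C_sub by (auto simp: mon_def hom_def)
  show "Collect normal_word = {ts. normal_word ts \<and> (ts = [] \<or> \<not> isl (hd ts))} \<union>
    {Inl t # r | t r. r \<in> {ts. normal_word ts \<and> (ts = [] \<or> \<not> isl (hd ts))} \<and>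
      t \<in> carrier G - (\<lambda>c. c) ` carrier (G\<lparr>carrier := C\<rparr>) \<and>
      coset_rep G ((\<lambda>c. c) ` carrier (G\<lparr>carrier := C\<rparr>)) t = t}" (is "?N = ?M")
  proof (rule Set.set_eqI)
    show "ts \<in> ?N \<longleftrightarrow> ts \<in> ?M" for ts
      by (cases ts; cases "hd ts") (auto simp: normal_word_Cons)
  qed
qed (auto simp: G.is_group)

sublocale right: factor_action A "G\<lparr>carrier := C\<rparr>" \<phi> Inr "Collect normal_word"
  "{ts. normal_word ts \<and> (ts = [] \<or> isl (hd ts))}"
proof (intro factor_action.intro factor_action_axioms.intro)
  show "group (G\<lparr>carrier := C\<rparr>)" using G.subgroup_imp_group[OF subgroup_C] .
  show "\<phi> \<in> mon (G\<lparr>carrier := C\<rparr>) A" by (rule phi_mon)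
  show "Collect normal_word = {ts. normal_word ts \<and> (ts = [] \<or> isl (hd ts))} \<union>
    {Inr t # r | t r. r \<in> {ts. normal_word ts \<and> (ts = [] \<or> isl (hd ts))} \<and>
      t \<in> carrier A - \<phi> ` carrier (G\<lparr>carrier := C\<rparr>) \<and>
      coset_rep A (\<phi> ` carrier (G\<lparr>carrier := C\<rparr>)) t = t}" (is "?N = ?M")
  proof (rule Set.set_eqI)
    show "ts \<in> ?N \<longleftrightarrow> ts \<in> ?M" for ts
      by (cases ts; cases "hd ts") (auto simp: normal_word_Cons)
  qed
qed (auto simp: A.is_group)

section \<open>Elements of the amalgam represented by normal forms\<close>

lemma cls_Cons:
  "x \<in> carrier G <+> carrier A \<Longrightarrow> w \<in> words G A \<Longrightarrow> cls (x # w) = cls [x] \<otimes>\<^bsub>P\<^esub> cls w"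
  by (simp add: mult_P)

lemma cls_append:
  "u \<in> words G A \<Longrightarrow> w \<in> words G A \<Longrightarrow> cls (u @ w) = cls u \<otimes>\<^bsub>P\<^esub> cls w"
  by (simp add: mult_P)

lemma cls_closed [simp]: "w \<in> words G A \<Longrightarrow> cls w \<in> carrier P"
  by (simp add: carrier_P)

lemma cls_merge_left:
  assumes "x \<in> carrier G" "y \<in> carrier G" "w \<in> words G A"
  shows "cls (Inl x # Inl y # w) = cls (Inl (x \<otimes>\<^bsub>G\<^esub> y) # w)"
  using amalg_rel.append[OF amalg_rel.left_mult[OF assms(1,2)] amalg_rel.refl[OF assms(3)]]
  by (intro cls_eqI) simp

lemma cls_merge_right:
  assumes "x \<in> carrier A" "y \<in> carrier A" "w \<in> words G A"
  shows "cls (Inr x # Inr y # w) = cls (Inr (x \<otimes>\<^bsub>A\<^esub> y) # w)"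
  using amalg_rel.append[OF amalg_rel.right_mult[OF assms(1,2)] amalg_rel.refl[OF assms(3)]]
  by (intro cls_eqI) simp

lemma cls_amalg:
  assumes "c \<in> C" "w \<in> words G A"
  shows "cls (Inl c # w) = cls (Inr (\<phi> c) # w)"
  using amalg_rel.append[OF amalg_rel.amalg[OF assms(1)] amalg_rel.refl[OF assms(2)]]
  by (intro cls_eqI) simp

abbreviation "\<Omega> \<equiv> C \<times> Collect normal_word"

definition nf_value :: "'a \<times> ('a + 'b) list \<Rightarrow> ('a + 'b) list set" where
  "nf_value \<omega> = cls (Inl (fst \<omega>) # snd \<omega>)"

lemma value_join_left:
  assumes "g \<in> carrier G" "normal_word r"
  shows "nf_value (left.join_nf (g, r)) = cls (Inl g # r)"
proof -
  have 1: "g \<otimes>\<^bsub>G\<^esub> inv\<^bsub>G\<^esub> coset_rep G C g \<in> C" "coset_rep G C g \<in> carrier G"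
    using G.mult_inv_coset_rep G.coset_rep_closed subgroup_C assms by auto
  then have "left.iota_inv (g \<otimes>\<^bsub>G\<^esub> inv\<^bsub>G\<^esub> coset_rep G C g) = g \<otimes>\<^bsub>G\<^esub> inv\<^bsub>G\<^esub> coset_rep G C g"
    using left.iota_iota_inv by simp
  moreover have "cls (Inl (g \<otimes>\<^bsub>G\<^esub> inv\<^bsub>G\<^esub> coset_rep G C g) # Inl (coset_rep G C g) # r) = cls (Inl g # r)"
    using cls_merge_left[OF _ 1(2) normal_word_words[OF assms(2)]] 1(2) assms(1) by (simp add: G.m_assoc)
  moreover have "g \<in> C \<Longrightarrow> g \<otimes>\<^bsub>G\<^esub> inv\<^bsub>G\<^esub> coset_rep G C g = g"
    using G.coset_rep_eq_one_iff[OF subgroup_C assms(1)] assms(1) by simp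
  ultimately show ?thesis by (simp add: nf_value_def left.join_nf_def)
qed

lemma value_join_right:
  assumes "a \<in> carrier A" "normal_word r"
  shows "nf_value (right.join_nf (a, r)) = cls (Inr a # r)"
proof -
  have D: "subgroup (\<phi> ` C) A" using right.subgroup_D by simp
  have 1: "a \<otimes>\<^bsub>A\<^esub> inv\<^bsub>A\<^esub> coset_rep A (\<phi> ` C) a \<in> \<phi> ` C" "coset_rep A (\<phi> ` C) a \<in> carrier A"
    using A.mult_inv_coset_rep[OF D] A.coset_rep_closed[OF D] assms by auto
  \<comment> \<open>A normal form stores its first factor as an element of \<open>C\<close>; the
    amalgamating relation turns it into its image in \<open>A\<close>.\<close>
  have 2: "cls (Inl (right.iota_inv d) # w) = cls (Inr d # w)" if "d \<in> \<phi> ` C" "w \<in> words G A" for d w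
    using cls_amalg[of "right.iota_inv d" w] right.iota_inv_closed[of d] right.iota_iota_inv[of d] that
    by simp
  have "cls (Inr (a \<otimes>\<^bsub>A\<^esub> inv\<^bsub>A\<^esub> coset_rep A (\<phi> ` C) a) # Inr (coset_rep A (\<phi> ` C) a) # r)
      = cls (Inr a # r)"
    using cls_merge_right[OF _ 1(2) normal_word_words[OF assms(2)]] 1(2) assms(1) by (simp add: A.m_assoc)
  moreover have "a \<in> \<phi> ` C \<Longrightarrow> a \<otimes>\<^bsub>A\<^esub> inv\<^bsub>A\<^esub> coset_rep A (\<phi> ` C) a = a"
    using A.coset_rep_eq_one_iff[OF D assms(1)] assms(1) by simp
  ultimately show ?thesis
    using 1 assms 2[of _ r] 2[of _ "Inr (coset_rep A (\<phi> ` C) a) # r"] normal_word_words[OF assms(2)]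
    by (simp add: nf_value_def right.join_nf_def)
qed

lemma value_act_left:
  assumes "g \<in> carrier G" "\<omega> \<in> \<Omega>"
  shows "nf_value (left.act g \<omega>) = cls [Inl g] \<otimes>\<^bsub>P\<^esub> nf_value \<omega>"
proof -
  obtain c ts where \<omega>: "\<omega> = (c, ts)" "c \<in> C" "normal_word ts" using assms(2) by auto
  obtain x r where s: "left.split_nf (c, ts) = (x, r)" by (cases "left.split_nf (c, ts)")
  then have xr: "x \<in> carrier G" "normal_word r"
    using left.split_closed[of c ts] \<omega> by auto
  have "nf_value \<omega> = cls (Inl x # r)"
    using left.join_split[of c ts] \<omega> s value_join_left[OF xr] by simp
  moreover have "left.act g \<omega> = left.join_nf (g \<otimes>\<^bsub>G\<^esub> x, r)"
    by (simp add: left.act_def s \<omega>(1))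
  then have "nf_value (left.act g \<omega>) = cls (Inl g # Inl x # r)"
    using value_join_left[of "g \<otimes>\<^bsub>G\<^esub> x" r] xr assms(1)
      cls_merge_left[OF assms(1) xr(1) normal_word_words[OF xr(2)]] by simp
  ultimately show ?thesis
    using cls_Cons[of "Inl g" "Inl x # r"] xr assms(1) normal_word_words[OF xr(2)] by simp
qed

lemma value_act_right:
  assumes "a \<in> carrier A" "\<omega> \<in> \<Omega>"
  shows "nf_value (right.act a \<omega>) = cls [Inr a] \<otimes>\<^bsub>P\<^esub> nf_value \<omega>"
proof -
  obtain c ts where \<omega>: "\<omega> = (c, ts)" "c \<in> C" "normal_word ts" using assms(2) by auto
  obtain x r where s: "right.split_nf (c, ts) = (x, r)" by (cases "right.split_nf (c, ts)")
  then have xr: "x \<in> carrier A" "normal_word r"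
    using right.split_closed[of c ts] \<omega> by auto
  have "nf_value \<omega> = cls (Inr x # r)"
    using right.join_split[of c ts] \<omega> s value_join_right[OF xr] by simp
  moreover have "right.act a \<omega> = right.join_nf (a \<otimes>\<^bsub>A\<^esub> x, r)"
    by (simp add: right.act_def s \<omega>(1))
  then have "nf_value (right.act a \<omega>) = cls (Inr a # Inr x # r)"
    using value_join_right[of "a \<otimes>\<^bsub>A\<^esub> x" r] xr assms(1)
      cls_merge_right[OF assms(1) xr(1) normal_word_words[OF xr(2)]] by simp
  ultimately show ?thesis
    using cls_Cons[of "Inr a" "Inr x # r"] xr assms(1) normal_word_words[OF xr(2)] by simp
qed

section \<open>The action of the amalgam on normal forms\<close>

definition action :: "('a + 'b) list set \<Rightarrow> 'a \<times> ('a + 'b) list \<Rightarrow> 'a \<times> ('a + 'b) list" where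
  "action = (SOME h. h \<in> hom P (BijGroup \<Omega>) \<and>
     (\<forall>x \<in> carrier G. h (emb_left x) = restrict (left.act x) \<Omega>) \<and>
     (\<forall>a \<in> carrier A. h (emb_right a) = restrict (right.act a) \<Omega>))"

text \<open>Existence is the universal property of the amalgam: on \<open>C\<close> both factor
  actions are multiplication of the first component.\<close>

lemma action:
  shows action_hom: "action \<in> hom P (BijGroup \<Omega>)"
    and action_left: "x \<in> carrier G \<Longrightarrow> \<omega> \<in> \<Omega> \<Longrightarrow> action (cls [Inl x]) \<omega> = left.act x \<omega>"
    and action_right: "a \<in> carrier A \<Longrightarrow> \<omega> \<in> \<Omega> \<Longrightarrow> action (cls [Inr a]) \<omega> = right.act a \<omega>"
proof -
  have "\<exists>h \<in> hom P (BijGroup \<Omega>).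
     (\<forall>x \<in> carrier G. h (emb_left x) = restrict (left.act x) \<Omega>) \<and>
     (\<forall>a \<in> carrier A. h (emb_right a) = restrict (right.act a) \<Omega>)"
  proof (rule extend_hom)
    show "group (BijGroup \<Omega>)" by (rule group_BijGroup)
    show "(\<lambda>x. restrict (left.act x) \<Omega>) \<in> hom G (BijGroup \<Omega>)" using left.act_hom by simp
    show "(\<lambda>x. restrict (right.act x) \<Omega>) \<in> hom A (BijGroup \<Omega>)" using right.act_hom by simp
    show "restrict (left.act c) \<Omega> = restrict (right.act (\<phi> c)) \<Omega>" if "c \<in> C" for c
    proof (rule restrict_ext)
      fix \<omega> assume "\<omega> \<in> \<Omega>"
      then obtain d ts where \<omega>: "\<omega> = (d, ts)" "d \<in> C" "normal_word ts" by auto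
      show "left.act c \<omega> = right.act (\<phi> c) \<omega>"
        using left.act_iota[of c d ts] right.act_iota[of c d ts] \<omega> that by simp
    qed
  qed
  then have *: "action \<in> hom P (BijGroup \<Omega>) \<and>
     (\<forall>x \<in> carrier G. action (emb_left x) = restrict (left.act x) \<Omega>) \<and>
     (\<forall>a \<in> carrier A. action (emb_right a) = restrict (right.act a) \<Omega>)"
    unfolding action_def Bex_def by (rule someI_ex)
  then show "action \<in> hom P (BijGroup \<Omega>)" by blast
  show "action (cls [Inl x]) \<omega> = left.act x \<omega>" if "x \<in> carrier G" "\<omega> \<in> \<Omega>"
    using * that by (auto simp: emb_left_def)
  show "action (cls [Inr a]) \<omega> = right.act a \<omega>" if "a \<in> carrier A" "\<omega> \<in> \<Omega>"
    using * that by (auto simp: emb_right_def)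
qed

lemma action_closed:
  assumes "X \<in> carrier P" "\<omega> \<in> \<Omega>"
  shows "action X \<omega> \<in> \<Omega>"
proof -
  have "action X \<in> Bij \<Omega>" using hom_in_carrier[OF action_hom assms(1)] by (simp add: BijGroup_def)
  then show ?thesis using assms(2) Bij_imp_funcset by blast
qed

lemma action_mult:
  assumes "X \<in> carrier P" "Y \<in> carrier P" "\<omega> \<in> \<Omega>"
  shows "action (X \<otimes>\<^bsub>P\<^esub> Y) \<omega> = action X (action Y \<omega>)"
proof -
  have "action X \<in> Bij \<Omega>" "action Y \<in> Bij \<Omega>"
    using hom_in_carrier[OF action_hom] assms by (auto simp: BijGroup_def)
  then show ?thesis
    using hom_mult[OF action_hom assms(1,2)] assms(3) by (simp add: BijGroup_def compose_eq)
qed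

lemma action_one:
  assumes "\<omega> \<in> \<Omega>"
  shows "action \<one>\<^bsub>P\<^esub> \<omega> = \<omega>"
proof -
  have "action \<one>\<^bsub>P\<^esub> = \<one>\<^bsub>BijGroup \<Omega>\<^esub>"
    using action_hom by (intro hom_one P.is_group group_BijGroup)
  then show ?thesis using assms by (simp add: BijGroup_def)
qed

lemma action_cls_Cons:
  assumes "x \<in> carrier G <+> carrier A" "w \<in> words G A" "\<omega> \<in> \<Omega>"
  shows "action (cls (x # w)) \<omega> = action (cls [x]) (action (cls w) \<omega>)"
  unfolding cls_Cons[OF assms(1,2)] using assms by (intro action_mult) auto

text \<open>Letter by letter, the action on normal forms realizes left multiplication on the
  represented elements.\<close>

lemma value_action:
  assumes "X \<in> carrier P" "\<omega> \<in> \<Omega>"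
  shows "nf_value (action X \<omega>) = X \<otimes>\<^bsub>P\<^esub> nf_value \<omega>"
proof -
  have val: "nf_value \<omega> \<in> carrier P"
    using assms(2) C_sub normal_word_words by (auto simp: nf_value_def)
  have "nf_value (action (cls w) \<omega>) = cls w \<otimes>\<^bsub>P\<^esub> nf_value \<omega>" if "w \<in> words G A" for w
    using that
  proof (induction w rule: list.induct)
    case Nil
    then show ?case using action_one[OF assms(2)] val by (simp add: one_P[symmetric])
  next
    case (Cons x w)
    then have w: "w \<in> words G A" "x \<in> carrier G <+> carrier A" by auto
    have "action (cls w) \<omega> \<in> \<Omega>" using w assms(2) by (intro action_closed) auto
    then have "nf_value (action (cls [x]) (action (cls w) \<omega>)) =
        cls [x] \<otimes>\<^bsub>P\<^esub> nf_value (action (cls w) \<omega>)"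
      using w(2) value_act_left value_act_right action_left action_right by (cases x) auto
    then show ?case
      unfolding action_cls_Cons[OF w(2,1) assms(2)] unfolding cls_Cons[OF w(2,1)]
      using Cons.IH[OF w(1)] w val by (simp add: P.m_assoc)
  qed
  with assms(1) show ?thesis by (auto simp: carrier_P)
qed

lemma one_in_C: "\<one>\<^bsub>G\<^esub> \<in> C"
  using subgroup.one_closed[OF subgroup_C] .

text \<open>Apply \<open>X\<close> to the normal form of the identity; the resulting normal form
  represents \<open>X\<close>.\<close>

lemma normal_form:
  assumes "X \<in> carrier P"
  obtains c ts where "c \<in> C" "normal_word ts" "X = cls (Inl c # ts)"
proof -
  have 1: "(\<one>\<^bsub>G\<^esub>, []) \<in> \<Omega>" using one_in_C by simp
  have "nf_value (\<one>\<^bsub>G\<^esub>, []) = \<one>\<^bsub>P\<^esub>"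
    unfolding nf_value_def one_P by (simp add: cls_eqI[OF amalg_rel.left_one])
  then have "X = nf_value (action X (\<one>\<^bsub>G\<^esub>, []))"
    using value_action[OF assms 1] assms by simp
  then show thesis
    using that action_closed[OF assms 1] by (auto simp: nf_value_def)
qed

text \<open>The sequence of factors through which the normal form runs, with \<open>True\<close> for
  \<open>G\<close>. Being defined by the action, it depends on the group element and not on a word
  for it.\<close>

definition sides :: "('a + 'b) list set \<Rightarrow> bool list" where
  "sides X = map isl (snd (action X (\<one>\<^bsub>G\<^esub>, [])))"

text \<open>Inductively, each letter meets a normal form that is empty or starts in the other
  factor, so it prepends a letter of its own side. The letters themselves may change, since they are
  replaced by representatives.\<close>

lemma action_reduced:
  assumes "reduced u" "c \<in> C"
  shows "map isl (snd (action (cls u) (c, []))) = map isl u"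
  using assms(1)
proof (induction u rule: list.induct)
  case Nil
  then show ?case using action_one[of "(c, [])"] assms(2) by (simp add: one_P[symmetric])
next
  case (Cons x u)
  have u: "u \<in> words G A" "reduced u" "proper x" "x \<in> carrier G <+> carrier A"
    using Cons.prems by (auto simp: reduced_Cons reduced_words proper_letter)
  have \<omega>: "action (cls u) (c, []) \<in> \<Omega>" using u assms(2) by (intro action_closed) auto
  obtain c' ts where ts: "action (cls u) (c, []) = (c', ts)" "c' \<in> C" "normal_word ts"
    using \<omega> by (cases "action (cls u) (c, [])") auto
  have m: "map isl ts = map isl u" using Cons.IH[OF u(2)] ts by simp
  then have hd: "ts = [] \<or> isl (hd ts) \<noteq> isl x"
    using Cons.prems by (cases ts; cases u) (auto simp: reduced_Cons)
  have act: "action (cls (x # u)) (c, []) = action (cls [x]) (c', ts)"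
    using action_cls_Cons[OF u(4,1), of "(c, [])"] assms(2) ts by simp
  show ?case
  proof (cases x)
    case (Inl g)
    then show ?thesis
      using left.act_proper[of g c' ts] u(3) ts hd act action_left[of g "(c', ts)"] m by auto
  next
    case (Inr a)
    then show ?thesis
      using right.act_proper[of a c' ts] u(3) ts hd act action_right[of a "(c', ts)"] m by auto
  qed
qed

text \<open>The right factor moves the base normal form to \<open>(c', [])\<close>, where
  \<open>action_reduced\<close> applies as well, and the left factor alters only the first
  component.\<close>

lemma sides_reduced:
  assumes "reduced u" "c \<in> C" "c' \<in> C"
  shows "sides (emb_left c \<otimes>\<^bsub>P\<^esub> cls u \<otimes>\<^bsub>P\<^esub> emb_left c') = map isl u"
proof -
  have act_C: "action (emb_left d) (d', ts) = (d \<otimes>\<^bsub>G\<^esub> d', ts)" if "d \<in> C" "d' \<in> C" "normal_word ts" for d d' ts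
    using action_left[of d "(d', ts)"] left.act_iota[of d d' ts] that C_sub
    by (auto simp: emb_left_def)
  have cl: "emb_left c \<in> carrier P" "emb_left c' \<in> carrier P" "cls u \<in> carrier P"
    using assms C_sub reduced_words by (auto simp: emb_left_def)
  have 1: "(\<one>\<^bsub>G\<^esub>, []) \<in> \<Omega>" and c': "(c', []) \<in> \<Omega>" using one_in_C assms by auto
  have e: "action (emb_left c') (\<one>\<^bsub>G\<^esub>, []) = (c', [])"
    using act_C[of c' "\<one>\<^bsub>G\<^esub>" "[]"] assms one_in_C C_sub by auto
  obtain d ts where ts: "action (cls u) (c', []) = (d, ts)" "d \<in> C" "normal_word ts"
    using action_closed[OF cl(3) c'] by (cases "action (cls u) (c', [])") auto
  have "action (emb_left c \<otimes>\<^bsub>P\<^esub> cls u \<otimes>\<^bsub>P\<^esub> emb_left c') (\<one>\<^bsub>G\<^esub>, []) = (c \<otimes>\<^bsub>G\<^esub> d, ts)"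
    using cl e 1 c' ts assms(2) by (simp add: action_mult act_C)
  then show ?thesis using action_reduced[OF assms(1,3)] ts by (simp add: sides_def)
qed

end

section \<open>The length function of an amalgamated product\<close>

text \<open>
  Twice the Gromov product of two edges of the Bass--Serre tree, whose paths from the base edge
  are given by the reversed normal forms: edges that part inside a common vertex group are
  still adjacent there, which accounts for the summand \<open>1\<close>.
\<close>

fun meet :: "('a + 'b) list \<Rightarrow> ('a + 'b) list \<Rightarrow> nat" where
  "meet (x # xs) (y # ys) =
     (if x = y then 2 + meet xs ys else if isl x = isl y then 1 else 0)"
| "meet _ _ = 0"

lemma meet_Nil [simp]: "meet xs [] = 0"
  by (cases xs) auto

lemma meet_commute: "meet xs ys = meet ys xs"
  by (induction xs ys rule: meet.induct) auto

lemma meet_ultrametric: "min (meet xs ys) (meet ys zs) \<le> meet xs zs"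
proof (induction xs ys arbitrary: zs rule: meet.induct)
  case (1 x xs y ys)
  show ?case
  proof (cases zs)
    case (Cons z zs')
    then show ?thesis using 1[of zs'] by auto
  qed simp
qed auto

text \<open>In an ultrametric situation the two smallest of the three sums agree.\<close>

lemma meet_four_point:
  "min (meet x z + meet y w) (meet x w + meet y z) \<le> meet x y + meet z w"
  using meet_ultrametric[of x z y] meet_ultrametric[of x w y]
    meet_ultrametric[of z x w] meet_ultrametric[of z y w]
  unfolding meet_commute[of z x] meet_commute[of w y] meet_commute[of z y]
  by linarith

text \<open>The hypothesis expresses distance through a Gromov product; in the four-point inequality
  all word lengths cancel and only \<open>meet\<close> remains.\<close>

lemma tree_length_meet:
  fixes w :: "'x \<Rightarrow> ('a + 'b) list"
  assumes "group G" and L: "\<And>x y. x \<in> carrier G \<Longrightarrow> y \<in> carrier G \<Longrightarrow>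
      L (x \<otimes>\<^bsub>G\<^esub> inv\<^bsub>G\<^esub> y) = int (length (w x)) + int (length (w y)) - int (meet (w x) (w y))"
    and one: "L \<one>\<^bsub>G\<^esub> = 0"
  shows "tree_length G L"
proof -
  interpret group G by fact
  show ?thesis
  proof
    fix x assume x: "x \<in> carrier G"
    show "L (inv\<^bsub>G\<^esub> x) = L x"
      using L[OF x one_closed] L[OF one_closed x] x meet_commute[of "w x"] by simp
  next
    fix x y z u
    assume c: "x \<in> carrier G" "y \<in> carrier G" "z \<in> carrier G" "u \<in> carrier G"
    show "L (x \<otimes>\<^bsub>G\<^esub> inv\<^bsub>G\<^esub> y) + L (z \<otimes>\<^bsub>G\<^esub> inv\<^bsub>G\<^esub> u)
      \<le> max (L (x \<otimes>\<^bsub>G\<^esub> inv\<^bsub>G\<^esub> z) + L (y \<otimes>\<^bsub>G\<^esub> inv\<^bsub>G\<^esub> u))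
          (L (x \<otimes>\<^bsub>G\<^esub> inv\<^bsub>G\<^esub> u) + L (y \<otimes>\<^bsub>G\<^esub> inv\<^bsub>G\<^esub> z))"
      unfolding L[OF c(1,2)] L[OF c(3,4)] L[OF c(1,3)] L[OF c(2,4)] L[OF c(1,4)] L[OF c(2,3)]
      using meet_four_point[of "w x" "w z" "w y" "w u"] by linarith
  qed (rule one)
qed

context amalgam_mon
begin

lemma subgroup_phi_C: "subgroup (\<phi> ` C) A"
  using right.subgroup_D by simp

lemma phi_C_closed: "c \<in> C \<Longrightarrow> \<phi> c \<in> carrier A"
  using phi_closed by blast

lemma C_closed: "c \<in> C \<Longrightarrow> c \<in> carrier G"
  using C_sub by blast

section \<open>Inverse words and the embedded factors\<close>

definition inv_letter :: "'a + 'b \<Rightarrow> 'a + 'b" where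
  "inv_letter = map_sum (m_inv G) (m_inv A)"

definition inv_word :: "('a + 'b) list \<Rightarrow> ('a + 'b) list" where
  "inv_word u = rev (map inv_letter u)"

lemma isl_inv_letter [simp]: "isl (inv_letter x) = isl x"
  by (cases x) (auto simp: inv_letter_def)

lemma inv_letter_closed:
  "x \<in> carrier G <+> carrier A \<Longrightarrow> inv_letter x \<in> carrier G <+> carrier A"
  by (cases x) (auto simp: inv_letter_def)

lemma inv_word_words: "u \<in> words G A \<Longrightarrow> inv_word u \<in> words G A"
  by (induction u rule: list.induct) (auto simp: inv_word_def inv_letter_closed)

lemma inv_word_Nil [simp]: "inv_word [] = []"
  by (simp add: inv_word_def)

lemma length_inv_word [simp]: "length (inv_word u) = length u"
  by (simp add: inv_word_def)

lemma last_inv_word: "u \<noteq> [] \<Longrightarrow> last (inv_word u) = inv_letter (hd u)"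
  by (simp add: inv_word_def last_rev hd_map)

lemma proper_inv_letter: "proper x \<Longrightarrow> proper (inv_letter x)"
proof (cases x)
  case (Inl g)
  assume "proper x"
  then show ?thesis
    using Inl subgroup.m_inv_closed[OF subgroup_C, of "inv\<^bsub>G\<^esub> g"] by (auto simp: inv_letter_def)
next
  case (Inr a)
  assume "proper x"
  then show ?thesis
    using Inr subgroup.m_inv_closed[OF subgroup_phi_C, of "inv\<^bsub>A\<^esub> a"] by (auto simp: inv_letter_def)
qed

lemma reduced_inv_word: "reduced u \<Longrightarrow> reduced (inv_word u)"
proof (induction u)
  case (Cons x u)
  then have "reduced (inv_word u)" "reduced [inv_letter x]"
    by (auto simp: reduced_Cons proper_inv_letter)
  moreover have "u \<noteq> [] \<Longrightarrow> isl (last (inv_word u)) \<noteq> isl x"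
    using Cons.prems by (auto simp: last_inv_word reduced_Cons)
  moreover have "inv_word (x # u) = inv_word u @ [inv_letter x]"
    by (simp add: inv_word_def)
  ultimately show ?case by (auto simp: reduced_append inv_word_def)
qed simp

lemma cls_inv_letter:
  assumes "x \<in> carrier G <+> carrier A"
  shows "cls [inv_letter x] = inv\<^bsub>P\<^esub> cls [x]"
proof -
  have "cls [inv_letter x] \<otimes>\<^bsub>P\<^esub> cls [x] = \<one>\<^bsub>P\<^esub>"
  proof (cases x)
    case (Inl g)
    then show ?thesis
      using assms cls_merge_left[of "inv\<^bsub>G\<^esub> g" g "[]"] cls_eqI[OF amalg_rel.left_one]
      by (simp add: inv_letter_def mult_P one_P)
  next
    case (Inr a)
    then show ?thesis
      using assms cls_merge_right[of "inv\<^bsub>A\<^esub> a" a "[]"] cls_eqI[OF amalg_rel.right_one]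
      by (simp add: inv_letter_def mult_P one_P)
  qed
  then have "inv\<^bsub>P\<^esub> cls [x] = cls [inv_letter x]"
    using assms inv_letter_closed[OF assms] by (intro P.inv_equality) auto
  then show ?thesis by simp
qed

lemma cls_inv_word:
  assumes "u \<in> words G A"
  shows "cls (inv_word u) = inv\<^bsub>P\<^esub> cls u"
  using assms
proof (induction u rule: list.induct)
  case Nil
  then show ?case by (simp add: one_P[symmetric])
next
  case (Cons x u)
  then have x: "x \<in> carrier G <+> carrier A" and u: "u \<in> words G A" by auto
  have "cls (inv_word (x # u)) = cls (inv_word u) \<otimes>\<^bsub>P\<^esub> cls [inv_letter x]"
    using cls_append[of "inv_word u" "[inv_letter x]"] inv_word_words[OF u] inv_letter_closed[OF x]
    by (simp add: inv_word_def)
  then show ?case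
    using Cons.IH[OF u] cls_inv_letter[OF x] cls_Cons[OF x u] x u by (simp add: P.inv_mult_group)
qed

lemma emb_left_closed: "g \<in> carrier G \<Longrightarrow> emb_left g \<in> carrier P"
  using emb_left_hom by (rule hom_in_carrier)

lemma emb_right_closed: "a \<in> carrier A \<Longrightarrow> emb_right a \<in> carrier P"
  using emb_right_hom by (rule hom_in_carrier)

lemma emb_left_mult:
  "g \<in> carrier G \<Longrightarrow> h \<in> carrier G \<Longrightarrow> emb_left (g \<otimes>\<^bsub>G\<^esub> h) = emb_left g \<otimes>\<^bsub>P\<^esub> emb_left h"
  using emb_left_hom by (rule hom_mult)

lemma emb_right_mult:
  "a \<in> carrier A \<Longrightarrow> b \<in> carrier A \<Longrightarrow> emb_right (a \<otimes>\<^bsub>A\<^esub> b) = emb_right a \<otimes>\<^bsub>P\<^esub> emb_right b"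
  using emb_right_hom by (rule hom_mult)

lemma emb_left_one: "emb_left \<one>\<^bsub>G\<^esub> = \<one>\<^bsub>P\<^esub>"
  unfolding emb_left_def one_P by (rule cls_eqI[OF amalg_rel.left_one])

lemma emb_right_one: "emb_right \<one>\<^bsub>A\<^esub> = \<one>\<^bsub>P\<^esub>"
  unfolding emb_right_def one_P by (rule cls_eqI[OF amalg_rel.right_one])

lemma emb_left_inv: "g \<in> carrier G \<Longrightarrow> emb_left (inv\<^bsub>G\<^esub> g) = inv\<^bsub>P\<^esub> emb_left g"
  using cls_inv_letter[of "Inl g"] by (simp add: emb_left_def inv_letter_def)

lemma sides_C:
  assumes "c \<in> C"
  shows "sides (emb_left c) = []"
  using sides_reduced[OF reduced_Nil assms one_in_C] emb_left_closed[OF C_closed[OF assms]]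
  by (simp add: emb_left_one one_P[symmetric])

lemma sides_cls:
  assumes "reduced u"
  shows "sides (cls u) = map isl u"
  using sides_reduced[OF assms one_in_C one_in_C] reduced_words[OF assms] by (simp add: emb_left_one)

lemma sides_emb_left:
  assumes "g \<in> carrier G"
  shows "sides (emb_left g) = (if g \<in> C then [] else [True])"
  using assms sides_C sides_cls[of "[Inl g]"] by (simp add: reduced_Cons emb_left_def)

lemma sides_emb_right:
  assumes "a \<in> carrier A"
  shows "sides (emb_right a) = (if a \<in> \<phi> ` C then [] else [False])"
proof (cases "a \<in> \<phi> ` C")
  case True
  then obtain c where c: "c \<in> C" "a = \<phi> c" by blast
  show ?thesis using sides_C[OF c(1)] emb_agree[OF c(1)] True by (simp add: c(2))
next
  case False
  then show ?thesis using assms sides_cls[of "[Inr a]"] by (simp add: reduced_Cons emb_right_def)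
qed

text \<open>Having no sides puts \<open>g\<close> into \<open>C\<close>, and then its action on the
  base normal form displays \<open>g\<close> as first component.\<close>

lemma emb_left_eq_one:
  assumes g: "g \<in> carrier G" and "emb_left g = \<one>\<^bsub>P\<^esub>"
  shows "g = \<one>\<^bsub>G\<^esub>"
proof -
  have "sides (emb_left g) = []" using assms(2) sides_C[OF one_in_C] by (simp add: emb_left_one)
  then have gC: "g \<in> C" using sides_emb_left[OF g] by (auto split: if_splits)
  have 1: "(\<one>\<^bsub>G\<^esub>, []) \<in> \<Omega>" using one_in_C by simp
  have "action (emb_left g) (\<one>\<^bsub>G\<^esub>, []) = (g, [])"
    using action_left[OF g 1] left.act_iota[of g "\<one>\<^bsub>G\<^esub>" "[]"] gC g one_in_C
    by (simp add: emb_left_def)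
  then show ?thesis using assms(2) action_one[OF 1] by simp
qed

lemma emb_right_eq_one:
  assumes a: "a \<in> carrier A" and 1: "emb_right a = \<one>\<^bsub>P\<^esub>"
  shows "a = \<one>\<^bsub>A\<^esub>"
proof -
  have "sides (emb_right a) = []" using 1 sides_C[OF one_in_C] by (simp add: emb_left_one)
  then obtain c where c: "c \<in> C" "a = \<phi> c" using sides_emb_right[OF a] by (auto split: if_splits)
  then have "c = \<one>\<^bsub>G\<^esub>" using emb_left_eq_one[OF C_closed[OF c(1)]] emb_agree[OF c(1)] 1 by simp
  then show ?thesis using c right.iota.hom_one by simp
qed

lemma emb_left_inj:
  assumes "g \<in> carrier G" "h \<in> carrier G" "emb_left g = emb_left h"
  shows "g = h"
proof -
  have "emb_left (g \<otimes>\<^bsub>G\<^esub> inv\<^bsub>G\<^esub> h) = \<one>\<^bsub>P\<^esub>"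
    using assms emb_left_closed by (simp add: emb_left_mult emb_left_inv)
  then have "g \<otimes>\<^bsub>G\<^esub> inv\<^bsub>G\<^esub> h = \<one>\<^bsub>G\<^esub>" using emb_left_eq_one assms by simp
  then show ?thesis using assms G.inv_equality[of g "inv\<^bsub>G\<^esub> h"] by simp
qed

text \<open>The leading element of \<open>C\<close> is absorbed into the first syllable, via
  \<open>\<phi>\<close> if that lies in \<open>A\<close>; a product of an element of the subgroup
  with one outside stays outside.\<close>

lemma reduced_form:
  assumes "X \<in> carrier P"
  shows "X \<in> emb_left ` C \<or> (\<exists>u. reduced u \<and> u \<noteq> [] \<and> X = cls u)"
proof -
  obtain c ts where X: "c \<in> C" "normal_word ts" "X = cls (Inl c # ts)"
    using normal_form[OF assms] .
  show ?thesis
  proof (cases ts)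
    case Nil
    then show ?thesis using X by (auto simp: emb_left_def)
  next
    case (Cons t r)
    then have r: "reduced r" "r \<in> words G A" "proper t" "r = [] \<or> isl t \<noteq> isl (hd r)"
      using X(2) reduced_words by (auto simp: normal_word_def reduced_Cons)
    show ?thesis
    proof (cases t)
      case (Inl g)
      then have g: "g \<in> carrier G" "g \<notin> C" using r by auto
      have "c \<otimes>\<^bsub>G\<^esub> g \<notin> C"
      proof
        assume "c \<otimes>\<^bsub>G\<^esub> g \<in> C"
        then have "inv\<^bsub>G\<^esub> c \<otimes>\<^bsub>G\<^esub> (c \<otimes>\<^bsub>G\<^esub> g) \<in> C"
          by (rule subgroup.m_closed[OF subgroup_C subgroup.m_inv_closed[OF subgroup_C X(1)]])
        then show False using g C_closed[OF X(1)] by (simp add: G.m_assoc[symmetric])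
      qed
      then have "reduced (Inl (c \<otimes>\<^bsub>G\<^esub> g) # r)" using r Inl g C_closed[OF X(1)] by (auto simp: reduced_Cons)
      moreover have "X = cls (Inl (c \<otimes>\<^bsub>G\<^esub> g) # r)"
        using X(3) Cons Inl cls_merge_left[OF C_closed[OF X(1)] g(1) r(2)] by simp
      ultimately show ?thesis by blast
    next
      case (Inr a)
      then have a: "a \<in> carrier A" "a \<notin> \<phi> ` C" using r by auto
      have c: "\<phi> c \<in> \<phi> ` C" "\<phi> c \<in> carrier A" using X(1) phi_C_closed by auto
      have "\<phi> c \<otimes>\<^bsub>A\<^esub> a \<notin> \<phi> ` C"
      proof
        assume "\<phi> c \<otimes>\<^bsub>A\<^esub> a \<in> \<phi> ` C"
        then have "inv\<^bsub>A\<^esub> \<phi> c \<otimes>\<^bsub>A\<^esub> (\<phi> c \<otimes>\<^bsub>A\<^esub> a) \<in> \<phi> ` C"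
          by (rule subgroup.m_closed[OF subgroup_phi_C subgroup.m_inv_closed[OF subgroup_phi_C c(1)]])
        then show False using a c by (simp add: A.m_assoc[symmetric])
      qed
      then have "reduced (Inr (\<phi> c \<otimes>\<^bsub>A\<^esub> a) # r)" using r Inr a c(2) by (auto simp: reduced_Cons)
      moreover have "X = cls (Inr (\<phi> c \<otimes>\<^bsub>A\<^esub> a) # r)"
        using X(3) Cons Inr cls_merge_right[OF c(2) a(1) r(2)] cls_amalg[of c "t # r"] X(1) r(2) a
        by simp
      ultimately show ?thesis by blast
    qed
  qed
qed

section \<open>The length of a quotient of two normal forms\<close>

definition len :: "('a + 'b) list set \<Rightarrow> int" where
  "len X = int (length (sides X))"

lemma len_reduced: "reduced u \<Longrightarrow> len (cls u) = int (length u)"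
  by (simp add: len_def sides_cls)

text \<open>Distinct representatives belong to distinct cosets, so their quotient is not in the
  amalgamated subgroup.\<close>

lemma merge_reps:
  assumes "proper x" "proper y" "is_rep x" "is_rep y" "isl x = isl y" "x \<noteq> y"
  shows "\<exists>z. proper z \<and> isl z = isl x \<and> cls [x, inv_letter y] = cls [z]"
proof (cases x)
  case (Inl g)
  then obtain h where y: "y = Inl h" using assms by (cases y) auto
  have "g \<otimes>\<^bsub>G\<^esub> inv\<^bsub>G\<^esub> h \<notin> C"
    using G.coset_rep_eq[OF subgroup_C, of g h] assms Inl y by auto
  then show ?thesis
    using assms Inl y cls_merge_left[of g "inv\<^bsub>G\<^esub> h" "[]"]
    by (intro exI[of _ "Inl (g \<otimes>\<^bsub>G\<^esub> inv\<^bsub>G\<^esub> h)"]) (simp add: inv_letter_def)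
next
  case (Inr a)
  then obtain b where y: "y = Inr b" using assms by (cases y) auto
  have "a \<otimes>\<^bsub>A\<^esub> inv\<^bsub>A\<^esub> b \<notin> \<phi> ` C"
    using A.coset_rep_eq[OF subgroup_phi_C, of a b] assms Inr y by auto
  then show ?thesis
    using assms Inr y cls_merge_right[of a "inv\<^bsub>A\<^esub> b" "[]"]
    by (intro exI[of _ "Inr (a \<otimes>\<^bsub>A\<^esub> inv\<^bsub>A\<^esub> b)"]) (simp add: inv_letter_def)
qed

lemma normal_word_append:
  "normal_word (u @ w) \<Longrightarrow> normal_word u \<and> normal_word w"
  by (auto simp: normal_word_def reduced_append)

text \<open>Cancelling the common end of two normal forms leaves a reduced word, up to merging two distinct
  representatives of one factor, whose quotient is not in the amalgamated subgroup.\<close>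

lemma quotient_reduced:
  assumes "normal_word ts" "normal_word ts'"
  shows "\<exists>u. reduced u \<and> cls u = cls ts \<otimes>\<^bsub>P\<^esub> inv\<^bsub>P\<^esub> cls ts' \<and>
    length u + meet (rev ts) (rev ts') = length ts + length ts'"
  using assms
\<comment> \<open>Cancellation takes place between the last letters, whence induction from the end
  and reversed words in \<open>meet\<close>.\<close>
proof (induction ts arbitrary: ts' rule: rev_induct)
  case Nil
  then show ?case
    using reduced_inv_word[of ts'] cls_inv_word[of ts'] normal_word_words[of ts']
    by (intro exI[of _ "inv_word ts'"]) (simp add: one_P[symmetric] normal_word_def)
next
  case (snoc x ts)
  note ts = normal_word_words[OF snoc.prems(1)] snoc.prems(1)
  show ?case
  proof (cases ts' rule: rev_cases)
    case Nil
    then show ?thesis using ts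
      by (intro exI[of _ "ts @ [x]"]) (simp add: one_P[symmetric] normal_word_def)
  next
    case (snoc ts\<^sub>1 y)
    note ts' = snoc.prems(2)[unfolded snoc]
    have n: "normal_word ts" "normal_word ts\<^sub>1" using ts(2) ts' normal_word_append by blast+
    have w: "ts \<in> words G A" "ts\<^sub>1 \<in> words G A" using n normal_word_words by auto
    have xy: "proper x" "is_rep x" "proper y" "is_rep y"
      using ts(2) ts' by (auto simp: normal_word_def reduced_def)
    note letters = proper_letter[OF xy(1)] proper_letter[OF xy(3)]
    have q: "cls (ts @ [x]) \<otimes>\<^bsub>P\<^esub> inv\<^bsub>P\<^esub> cls ts' =
        cls ts \<otimes>\<^bsub>P\<^esub> (cls [x, inv_letter y] \<otimes>\<^bsub>P\<^esub> inv\<^bsub>P\<^esub> cls ts\<^sub>1)"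
      using w letters inv_letter_closed[OF letters(2)] cls_inv_letter[OF letters(2)]
        cls_Cons[of x "[inv_letter y]"]
      by (simp add: snoc cls_append P.inv_mult_group P.m_assoc)
    show ?thesis
    \<comment> \<open>Equal last letters cancel and cost two letters; distinct ones of the same
      factor merge and cost one; letters of different factors cost none. These are the values added
      by \<open>meet\<close>.\<close>
    proof (cases "x = y")
      case True
      have "cls [x, inv_letter x] = \<one>\<^bsub>P\<^esub>"
        using cls_Cons[of x "[inv_letter x]"] letters inv_letter_closed cls_inv_letter by simp
      moreover obtain u where "reduced u" "cls u = cls ts \<otimes>\<^bsub>P\<^esub> inv\<^bsub>P\<^esub> cls ts\<^sub>1"
        "length u + meet (rev ts) (rev ts\<^sub>1) = length ts + length ts\<^sub>1"
        using snoc.IH[OF n] by blast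
      ultimately show ?thesis using q w True by (intro exI[of _ u]) (simp add: snoc)
    next
      case False
      have r: "reduced ts" "reduced (inv_word ts\<^sub>1)" "inv_word ts\<^sub>1 \<in> words G A"
        using n reduced_inv_word inv_word_words w by (auto simp: normal_word_def)
      have l: "ts \<noteq> [] \<Longrightarrow> isl (last ts) \<noteq> isl x"
        using ts(2) by (auto simp: normal_word_def reduced_append)
      have h: "ts\<^sub>1 \<noteq> [] \<Longrightarrow> isl (hd (inv_word ts\<^sub>1)) \<noteq> isl y"
        using ts' by (auto simp: normal_word_def reduced_append inv_word_def hd_rev last_map)
      show ?thesis
      proof (cases "isl x = isl y")
        case True
        obtain z where z: "proper z" "isl z = isl x" "cls [x, inv_letter y] = cls [z]"
          using merge_reps[OF xy(1,3,2,4) True False] by blast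
        have "cls (ts @ [z] @ inv_word ts\<^sub>1) = cls (ts @ [x]) \<otimes>\<^bsub>P\<^esub> inv\<^bsub>P\<^esub> cls ts'"
          using w r(3) proper_letter[OF z(1)] cls_inv_word[OF w(2)] q z(3)
          by (simp add: cls_append cls_Cons[of z "inv_word ts\<^sub>1"])
        moreover have "reduced (ts @ [z] @ inv_word ts\<^sub>1)"
          using r z l h True by (auto simp: reduced_append reduced_Cons inv_word_def)
        ultimately show ?thesis using False True
          by (intro exI[of _ "ts @ [z] @ inv_word ts\<^sub>1"]) (simp add: snoc)
      next
        case False': False
        have "cls (ts @ [x, inv_letter y] @ inv_word ts\<^sub>1) = cls (ts @ [x]) \<otimes>\<^bsub>P\<^esub> inv\<^bsub>P\<^esub> cls ts'"
          using w r(3) letters inv_letter_closed[OF letters(2)] cls_inv_word[OF w(2)] q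
            cls_append[of "[x, inv_letter y]" "inv_word ts\<^sub>1"]
            cls_append[of ts "[x, inv_letter y] @ inv_word ts\<^sub>1"]
          by simp
        moreover have "reduced (ts @ [x, inv_letter y] @ inv_word ts\<^sub>1)"
          using r xy l h False' proper_inv_letter
          by (auto simp: reduced_append reduced_Cons inv_word_def)
        ultimately show ?thesis using False False'
          by (intro exI[of _ "ts @ [x, inv_letter y] @ inv_word ts\<^sub>1"]) (simp add: snoc)
      qed
    qed
  qed
qed

text \<open>\<open>w\<close> picks a normal form for each element. In a quotient the components in
  \<open>C\<close> end up on the outside, where they do not affect \<open>sides\<close>, so the
  length is that of \<open>quotient_reduced\<close>.\<close>

sublocale tree: tree_length P len
proof -
  have "\<forall>X \<in> carrier P. \<exists>ts. \<exists>c \<in> C. normal_word ts \<and> X = cls (Inl c # ts)"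
    using normal_form by blast
  then obtain w where w: "\<And>X. X \<in> carrier P \<Longrightarrow> \<exists>c \<in> C. normal_word (w X) \<and> X = cls (Inl c # w X)"
    by metis
  have "len (X \<otimes>\<^bsub>P\<^esub> inv\<^bsub>P\<^esub> Y) = int (length (rev (w X))) + int (length (rev (w Y)))
      - int (meet (rev (w X)) (rev (w Y)))"
    if X: "X \<in> carrier P" and Y: "Y \<in> carrier P" for X Y
  proof -
    obtain c where c: "c \<in> C" "normal_word (w X)" "X = cls (Inl c # w X)" using w[OF X] by blast
    obtain d where d: "d \<in> C" "normal_word (w Y)" "Y = cls (Inl d # w Y)" using w[OF Y] by blast
    obtain u where u: "reduced u" "cls u = cls (w X) \<otimes>\<^bsub>P\<^esub> inv\<^bsub>P\<^esub> cls (w Y)"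
      "length u + meet (rev (w X)) (rev (w Y)) = length (w X) + length (w Y)"
      using quotient_reduced[OF c(2) d(2)] by blast
    note cl = C_closed[OF c(1)] C_closed[OF d(1)] normal_word_words[OF c(2)] normal_word_words[OF d(2)]
    have "X = emb_left c \<otimes>\<^bsub>P\<^esub> cls (w X)" "Y = emb_left d \<otimes>\<^bsub>P\<^esub> cls (w Y)"
      using c(3) d(3) cl cls_Cons[of "Inl c" "w X"] cls_Cons[of "Inl d" "w Y"]
      by (simp_all add: emb_left_def)
    then have "X \<otimes>\<^bsub>P\<^esub> inv\<^bsub>P\<^esub> Y = emb_left c \<otimes>\<^bsub>P\<^esub> cls (w X) \<otimes>\<^bsub>P\<^esub> inv\<^bsub>P\<^esub> (emb_left d \<otimes>\<^bsub>P\<^esub> cls (w Y))"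
      by metis
    also have "\<dots> = emb_left c \<otimes>\<^bsub>P\<^esub> cls u \<otimes>\<^bsub>P\<^esub> emb_left (inv\<^bsub>G\<^esub> d)"
      using cl emb_left_closed u(2) by (simp add: P.inv_mult_group P.m_assoc emb_left_inv)
    finally have "sides (X \<otimes>\<^bsub>P\<^esub> inv\<^bsub>P\<^esub> Y) = map isl u"
      using sides_reduced[OF u(1) c(1)] subgroup.m_inv_closed[OF subgroup_C d(1)] by simp
    then show ?thesis using u(3) by (simp add: len_def)
  qed
  moreover have "len \<one>\<^bsub>P\<^esub> = 0" using sides_C[OF one_in_C] by (simp add: len_def emb_left_one)
  ultimately show "tree_length P len" by (rule tree_length_meet[OF P.is_group])
qed

end

section \<open>Elliptic elements and malnormal amalgams\<close>

context amalgam_mon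
begin

text \<open>In terms of the Bass--Serre tree, \<open>X\<close> fixes a vertex.\<close>

definition elliptic :: "('a + 'b) list set \<Rightarrow> bool" where
  "elliptic X \<longleftrightarrow> (\<exists>p \<in> carrier P.
     inv\<^bsub>P\<^esub> p \<otimes>\<^bsub>P\<^esub> X \<otimes>\<^bsub>P\<^esub> p \<in> emb_left ` carrier G \<union> emb_right ` carrier A)"

lemma len_factor: "Y \<in> emb_left ` carrier G \<union> emb_right ` carrier A \<Longrightarrow> len Y \<le> 1"
  by (auto simp: len_def sides_emb_left sides_emb_right)

lemma len_letter:
  assumes "x \<in> carrier G <+> carrier A"
  shows "len (cls [x]) \<le> 1"
  using assms len_factor[of "cls [x]"] by (cases x) (auto simp: emb_left_def emb_right_def)

lemma letter_factor:
  assumes "x \<in> carrier G <+> carrier A"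
  shows "cls [x] \<in> emb_left ` carrier G \<union> emb_right ` carrier A"
  using assms by (cases x) (auto simp: emb_left_def emb_right_def)

text \<open>The statement about the first letter carries the induction: it ensures alternation where
  two copies of \<open>u\<close> meet.\<close>

lemma reduced_concat_replicate:
  assumes "reduced u" "u \<noteq> []" "isl (hd u) \<noteq> isl (last u)"
  shows "reduced (concat (replicate n u)) \<and> (n > 0 \<longrightarrow> hd (concat (replicate n u)) = hd u)"
proof (induction n)
  case (Suc n)
  have "concat (replicate n u) = [] \<or> n > 0" by (cases n) auto
  then show ?case using Suc assms by (auto simp: reduced_append)
qed simp

lemma cls_concat_replicate:
  assumes "u \<in> words G A"
  shows "concat (replicate n u) \<in> words G A \<and> cls (concat (replicate n u)) = cls u [^]\<^bsub>P\<^esub> n"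
proof (induction n)
  case (Suc n)
  have "cls u [^]\<^bsub>P\<^esub> Suc n = cls u \<otimes>\<^bsub>P\<^esub> cls u [^]\<^bsub>P\<^esub> n" by (rule P.nat_pow_Suc2) (use assms in simp)
  then show ?case using Suc assms cls_append[of u "concat (replicate n u)"] by simp
qed (simp add: one_P)

lemma filterlim_linear_int: "a > 0 \<Longrightarrow> filterlim (\<lambda>n. int n * a - b) at_top sequentially"
proof -
  assume a: "a > 0"
  show ?thesis
    unfolding filterlim_at_top eventually_sequentially
  proof
    fix K
    have "K \<le> int n * a - b" if "n \<ge> nat (K + b)" for n
    proof -
      have "int n * a \<ge> int n * 1" using a by (intro mult_left_mono) auto
      then show ?thesis using that by linarith
    qed
    then show "\<exists>N. \<forall>n\<ge>N. K \<le> int n * a - b" by blast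
  qed
qed

text \<open>Take a conjugate of minimal length. If it is in \<open>C\<close> or a single letter,
  \<open>X\<close> is elliptic. If it begins and ends in different factors, its powers are products
  without cancellation and grow linearly. Longer words with both ends in one factor could be
  shortened.\<close>

lemma elliptic_or_hyperbolic:
  assumes X: "X \<in> carrier P"
  shows "elliptic X \<or> tree.hyperbolic X"
proof -
  define c where "c p = inv\<^bsub>P\<^esub> p \<otimes>\<^bsub>P\<^esub> X \<otimes>\<^bsub>P\<^esub> p" for p
  obtain p where p: "p \<in> carrier P" and min: "\<And>q. q \<in> carrier P \<Longrightarrow> len (c p) \<le> len (c q)"
    using ex_has_least_nat[of "\<lambda>p. p \<in> carrier P" "\<one>\<^bsub>P\<^esub>" "\<lambda>p. length (sides (c p))"]
    by (auto simp: len_def)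
  have cp: "c p \<in> carrier P" using p X by (simp add: c_def)
  from reduced_form[OF cp] show ?thesis
  proof
    assume "c p \<in> emb_left ` C"
    then show ?thesis using p C_sub unfolding elliptic_def c_def by blast
  next
    assume "\<exists>u. reduced u \<and> u \<noteq> [] \<and> c p = cls u"
    then obtain u where u: "reduced u" "u \<noteq> []" "c p = cls u" by blast
    note uw = reduced_words[OF u(1)]
    show ?thesis
    proof (cases "isl (hd u) = isl (last u)")
      case False
      \<comment> \<open>Undoing the conjugation by \<open>p\<close> changes the length of each power
        by at most \<open>2 * len p\<close>, independently of \<open>n\<close>.\<close>
      have "len (X [^]\<^bsub>P\<^esub> n) \<ge> int n * int (length u) - 2 * len p" for n :: nat
      proof -
        have "length (concat (replicate n u)) = n * length u"
          by (induction n) auto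
        then have "len (cls u [^]\<^bsub>P\<^esub> n) = int n * int (length u)"
          using len_reduced[of "concat (replicate n u)"] reduced_concat_replicate[OF u(1,2) False]
            cls_concat_replicate[OF uw] by simp
        moreover have "c p [^]\<^bsub>P\<^esub> n = inv\<^bsub>P\<^esub> p \<otimes>\<^bsub>P\<^esub> X [^]\<^bsub>P\<^esub> n \<otimes>\<^bsub>P\<^esub> p"
          unfolding c_def by (rule P.conj_pow[OF p X])
        ultimately show ?thesis
          using tree.L_conj_le(1)[OF p, of "X [^]\<^bsub>P\<^esub> n"] X u(3) by simp
      qed
      moreover have "filterlim (\<lambda>n. int n * int (length u) - 2 * len p) at_top sequentially"
        using u(2) by (intro filterlim_linear_int) simp
      ultimately have "filterlim (\<lambda>n. len (X [^]\<^bsub>P\<^esub> n)) at_top sequentially"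
        by (rule filterlim_at_top_mono[OF _ always_eventually, OF _ allI, rotated])
      then show ?thesis using X by (simp add: tree.hyperbolic_def)
    next
      case True
      show ?thesis
      proof (cases "tl u")
        case Nil
        then obtain x where "u = [x]" "x \<in> carrier G <+> carrier A"
          using u uw by (cases u) auto
        then have "c p \<in> emb_left ` carrier G \<union> emb_right ` carrier A"
          using letter_factor u(3) by simp
        then show ?thesis using p unfolding elliptic_def c_def by blast
      next
        case (Cons t ts)
        \<comment> \<open>Conjugating by the last letter merges it with the first one, contradicting minimality.\<close>
        obtain x w y where xwy: "u = x # w @ [y]"
          using u(2) Cons by (cases u; cases "tl u" rule: rev_cases) auto
        have l: "x \<in> carrier G <+> carrier A" "y \<in> carrier G <+> carrier A" "w \<in> words G A" "reduced w"
          using uw u(1) by (auto simp: xwy reduced_Cons reduced_append)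
        have "\<exists>z \<in> carrier G <+> carrier A. cls [y, x] = cls [z]"
        proof (cases x)
          case (Inl g)
          then obtain h where "y = Inl h" using True xwy by (cases y) auto
          then show ?thesis using Inl l cls_merge_left[of h g "[]"]
            by (intro bexI[of _ "Inl (h \<otimes>\<^bsub>G\<^esub> g)"]) simp_all
        next
          case (Inr a)
          then obtain b where "y = Inr b" using True xwy by (cases y) auto
          then show ?thesis using Inr l cls_merge_right[of b a "[]"]
            by (intro bexI[of _ "Inr (b \<otimes>\<^bsub>A\<^esub> a)"]) simp_all
        qed
        then obtain z where z: "z \<in> carrier G <+> carrier A" "cls [y, x] = cls [z]" by blast
        define q where "q = p \<otimes>\<^bsub>P\<^esub> inv\<^bsub>P\<^esub> cls [y]"
        have ycl: "cls [y] \<in> carrier P" "cls [x] \<in> carrier P" "cls w \<in> carrier P" using l by auto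
        have q: "q \<in> carrier P" using p ycl by (simp add: q_def)
        have "c q = cls [y] \<otimes>\<^bsub>P\<^esub> c p \<otimes>\<^bsub>P\<^esub> inv\<^bsub>P\<^esub> cls [y]"
          unfolding c_def q_def using P.conj_conj[OF p P.inv_closed[OF ycl(1)] X] ycl by simp
        also have "c p = cls [x] \<otimes>\<^bsub>P\<^esub> (cls w \<otimes>\<^bsub>P\<^esub> cls [y])"
          using u(3) l by (simp add: xwy cls_Cons[of x "w @ [y]"] cls_append[of w])
        also have "cls [y] \<otimes>\<^bsub>P\<^esub> (cls [x] \<otimes>\<^bsub>P\<^esub> (cls w \<otimes>\<^bsub>P\<^esub> cls [y])) \<otimes>\<^bsub>P\<^esub> inv\<^bsub>P\<^esub> cls [y]
            = cls [y] \<otimes>\<^bsub>P\<^esub> cls [x] \<otimes>\<^bsub>P\<^esub> cls w"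
          using ycl by (simp add: P.m_assoc)
        also have "\<dots> = cls [z] \<otimes>\<^bsub>P\<^esub> cls w"
          using z(2) cls_Cons[of y "[x]"] l by simp
        finally have "len (c q) \<le> 1 + int (length w)"
          using tree.L_mult_le[of "cls [z]" "cls w"] z(1) ycl len_letter[OF z(1)] len_reduced[OF l(4)]
          by simp
        moreover have "len (c p) = int (length w) + 2"
          using len_reduced[OF u(1)] u(3) by (simp add: xwy)
        ultimately show ?thesis using min[OF q] by simp
      qed
    qed
  qed
qed

text \<open>An element with trivial square has only two powers, so it is not hyperbolic; being
  elliptic, it reduces to the embedded factors.\<close>

lemma no_order_two_amalgam:
  assumes G2: "no_order_two G" and A2: "no_order_two A"
  shows "no_order_two P"
  unfolding P.no_order_two_iff
proof (intro ballI impI)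
  fix X assume X: "X \<in> carrier P" and XX: "X \<otimes>\<^bsub>P\<^esub> X = \<one>\<^bsub>P\<^esub>"
  have "\<not> tree.hyperbolic X"
  proof
    assume "tree.hyperbolic X"
    have "X [^]\<^bsub>P\<^esub> n \<in> {\<one>\<^bsub>P\<^esub>, X}" for n :: nat
      by (induction n) (use X XX in auto)
    then have "len (X [^]\<^bsub>P\<^esub> n) \<le> len X" for n :: nat
      using tree.L_nonneg[OF X] tree.L_one by (metis insertE order_refl singletonD)
    with tree.hyperbolic_eventually[OF \<open>tree.hyperbolic X\<close>, of "len X"]
    show False by (auto dest!: eventually_happens simp: not_le[symmetric])
  qed
  then obtain p where p: "p \<in> carrier P"
    "inv\<^bsub>P\<^esub> p \<otimes>\<^bsub>P\<^esub> X \<otimes>\<^bsub>P\<^esub> p \<in> emb_left ` carrier G \<union> emb_right ` carrier A"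
    using elliptic_or_hyperbolic[OF X] unfolding elliptic_def by blast
  define Y where "Y = inv\<^bsub>P\<^esub> p \<otimes>\<^bsub>P\<^esub> X \<otimes>\<^bsub>P\<^esub> p"
  have "Y \<otimes>\<^bsub>P\<^esub> Y = inv\<^bsub>P\<^esub> p \<otimes>\<^bsub>P\<^esub> \<one>\<^bsub>P\<^esub> \<otimes>\<^bsub>P\<^esub> p"
    using P.conj_mult[OF p(1) X X] unfolding Y_def XX by (rule HOL.sym)
  then have YY: "Y \<otimes>\<^bsub>P\<^esub> Y = \<one>\<^bsub>P\<^esub>" using p(1) by simp
  from p(2)[folded Y_def] have "Y = \<one>\<^bsub>P\<^esub>"
  proof
    assume "Y \<in> emb_left ` carrier G"
    then obtain g where g: "g \<in> carrier G" "Y = emb_left g" by blast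
    then have "g \<otimes>\<^bsub>G\<^esub> g = \<one>\<^bsub>G\<^esub>" using YY emb_left_eq_one[of "g \<otimes>\<^bsub>G\<^esub> g"] by (simp add: emb_left_mult)
    then have "g = \<one>\<^bsub>G\<^esub>" using G2 g(1) unfolding G.no_order_two_iff by blast
    then show ?thesis by (simp add: g(2) emb_left_one)
  next
    assume "Y \<in> emb_right ` carrier A"
    then obtain a where a: "a \<in> carrier A" "Y = emb_right a" by blast
    then have "a \<otimes>\<^bsub>A\<^esub> a = \<one>\<^bsub>A\<^esub>" using YY emb_right_eq_one[of "a \<otimes>\<^bsub>A\<^esub> a"] by (simp add: emb_right_mult)
    then have "a = \<one>\<^bsub>A\<^esub>" using A2 a(1) unfolding A.no_order_two_iff by blast
    then show ?thesis by (simp add: a(2) emb_right_one)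
  qed
  then show "X = \<one>\<^bsub>P\<^esub>" using P.conj_eq_one_iff[OF p(1) X] by (simp add: Y_def)
qed

text \<open>The written-out conjugate is already reduced and has \<open>2 * length u + 1\<close>
  letters, whereas elements of a factor have length at most one. This is the obstruction behind both
  malnormality results below.\<close>

lemma len_conj_reduced:
  assumes "reduced u" "u \<noteq> []" "proper y" "isl y \<noteq> isl (hd u)"
  shows "len (inv\<^bsub>P\<^esub> cls u \<otimes>\<^bsub>P\<^esub> cls [y] \<otimes>\<^bsub>P\<^esub> cls u) > 1"
proof -
  have w: "u \<in> words G A" "inv_word u \<in> words G A" "y \<in> carrier G <+> carrier A"
    using assms reduced_words inv_word_words proper_letter by auto
  have "reduced (inv_word u @ [y] @ u)"
    using assms reduced_inv_word[OF assms(1)]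
    by (auto simp: reduced_append reduced_Cons last_inv_word)
  moreover have "cls (inv_word u @ [y] @ u) = inv\<^bsub>P\<^esub> cls u \<otimes>\<^bsub>P\<^esub> cls [y] \<otimes>\<^bsub>P\<^esub> cls u"
    using w cls_inv_word[OF w(1)] cls_append[of "inv_word u" "[y] @ u"] cls_Cons[of y u]
    by (simp add: P.m_assoc)
  ultimately show ?thesis
    using len_reduced[of "inv_word u @ [y] @ u"] assms(2) by simp
qed

end

section \<open>Malnormality of the factors\<close>

locale malnormal_amalgam = amalgam_mon +
  assumes A_comm: "x \<in> carrier A \<Longrightarrow> y \<in> carrier A \<Longrightarrow> x \<otimes>\<^bsub>A\<^esub> y = y \<otimes>\<^bsub>A\<^esub> x"
    and malnormal: "g \<in> carrier G - C \<Longrightarrow> c \<in> C \<Longrightarrow> inv\<^bsub>G\<^esub> g \<otimes>\<^bsub>G\<^esub> c \<otimes>\<^bsub>G\<^esub> g \<in> C \<Longrightarrow> c = \<one>\<^bsub>G\<^esub>"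
begin

lemma emb_right_comm:
  "a \<in> carrier A \<Longrightarrow> b \<in> carrier A \<Longrightarrow> emb_right a \<otimes>\<^bsub>P\<^esub> emb_right b = emb_right b \<otimes>\<^bsub>P\<^esub> emb_right a"
  using A_comm[of a b] by (simp add: emb_right_mult[symmetric])

lemma emb_left_conj:
  "g \<in> carrier G \<Longrightarrow> h \<in> carrier G \<Longrightarrow>
    inv\<^bsub>P\<^esub> emb_left h \<otimes>\<^bsub>P\<^esub> emb_left g \<otimes>\<^bsub>P\<^esub> emb_left h = emb_left (inv\<^bsub>G\<^esub> h \<otimes>\<^bsub>G\<^esub> g \<otimes>\<^bsub>G\<^esub> h)"
  by (simp add: emb_left_mult emb_left_inv)

lemma emb_left_cls: "g \<in> carrier G \<Longrightarrow> w \<in> words G A \<Longrightarrow> cls (Inl g # w) = emb_left g \<otimes>\<^bsub>P\<^esub> cls w"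
  using cls_Cons[of "Inl g" w] by (simp add: emb_left_def)

lemma emb_right_cls: "a \<in> carrier A \<Longrightarrow> w \<in> words G A \<Longrightarrow> cls (Inr a # w) = emb_right a \<otimes>\<^bsub>P\<^esub> cls w"
  using cls_Cons[of "Inr a" w] by (simp add: emb_right_def)

text \<open>If \<open>X\<close> is not in \<open>A\<close>, remove a leading letter of
  \<open>A\<close>, which commutes with \<open>a\<close>. For \<open>a\<close> outside the
  amalgamated subgroup the conjugate is then too long. Otherwise \<open>a\<close> is read in
  \<open>G\<close>, and malnormality of \<open>C\<close> moves it out of \<open>C\<close> under the
  first letter.\<close>

lemma right_malnormal:
  assumes a: "a \<in> carrier A" "a \<noteq> \<one>\<^bsub>A\<^esub>" and X: "X \<in> carrier P"
    and conj: "inv\<^bsub>P\<^esub> X \<otimes>\<^bsub>P\<^esub> emb_right a \<otimes>\<^bsub>P\<^esub> X \<in> emb_right ` carrier A"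
  shows "X \<in> emb_right ` carrier A"
proof (rule ccontr)
  assume notin: "X \<notin> emb_right ` carrier A"
  have ea: "emb_right a \<in> carrier P" by (rule emb_right_closed[OF a(1)])
  have "X \<notin> emb_left ` C" using notin emb_agree phi_C_closed by auto
  then obtain w where w: "reduced w" "w \<noteq> []" "X = cls w" using reduced_form[OF X] by blast
  \<comment> \<open>\<open>u\<close> is the word of \<open>X\<close> without a possible first letter
    from \<open>A\<close>. It is nonempty because \<open>X\<close> is not in
    \<open>A\<close>.\<close>
  have "\<exists>u. reduced u \<and> u \<noteq> [] \<and> isl (hd u) \<and>
    inv\<^bsub>P\<^esub> X \<otimes>\<^bsub>P\<^esub> emb_right a \<otimes>\<^bsub>P\<^esub> X = inv\<^bsub>P\<^esub> cls u \<otimes>\<^bsub>P\<^esub> emb_right a \<otimes>\<^bsub>P\<^esub> cls u"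
  proof (cases "hd w")
    case (Inl g)
    then show ?thesis using w by (intro exI[of _ w]) simp
  next
    case (Inr b)
    then obtain w' where w': "w = Inr b # w'" using w(2) by (cases w) auto
    then have b: "b \<in> carrier A" "reduced w'" using w(1) by (auto simp: reduced_Cons)
    have "w' \<noteq> []" using notin w(3) w' b by (auto simp: emb_right_def)
    then have "isl (hd w')" using w(1) w' by (simp add: reduced_Cons)
    have "X = emb_right b \<otimes>\<^bsub>P\<^esub> cls w'"
      using w(3) w' emb_right_cls[OF b(1) reduced_words[OF b(2)]] by simp
    moreover have "inv\<^bsub>P\<^esub> emb_right b \<otimes>\<^bsub>P\<^esub> emb_right a \<otimes>\<^bsub>P\<^esub> emb_right b = emb_right a"
      using P.conj_fixes_iff[OF emb_right_closed[OF b(1)] ea] emb_right_comm[OF b(1) a(1)] by simp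
    ultimately have "inv\<^bsub>P\<^esub> X \<otimes>\<^bsub>P\<^esub> emb_right a \<otimes>\<^bsub>P\<^esub> X = inv\<^bsub>P\<^esub> cls w' \<otimes>\<^bsub>P\<^esub> emb_right a \<otimes>\<^bsub>P\<^esub> cls w'"
      using P.conj_conj[OF emb_right_closed[OF b(1)] cls_closed[OF reduced_words[OF b(2)]] ea] by simp
    then show ?thesis using \<open>w' \<noteq> []\<close> \<open>isl (hd w')\<close> b(2) by blast
  qed
  then obtain u where u: "reduced u" "u \<noteq> []" "isl (hd u)"
    "inv\<^bsub>P\<^esub> cls u \<otimes>\<^bsub>P\<^esub> emb_right a \<otimes>\<^bsub>P\<^esub> cls u \<in> emb_right ` carrier A"
    using conj by metis
  show False
  proof (cases "a \<in> \<phi> ` C")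
    case False
    then show False
      using len_conj_reduced[OF u(1,2), of "Inr a"] a u(3) len_factor u(4)
      by (force simp: emb_right_def)
  next
    case True
    then obtain c where c: "c \<in> C" "a = \<phi> c" by blast
    note cG = C_closed[OF c(1)]
    obtain g u' where u': "u = Inl g # u'" using u(2,3) by (cases u; cases "hd u") auto
    then have g: "g \<in> carrier G" "g \<notin> C" "reduced u'" using u(1) by (auto simp: reduced_Cons)
    define h where "h = inv\<^bsub>G\<^esub> g \<otimes>\<^bsub>G\<^esub> c \<otimes>\<^bsub>G\<^esub> g"
    have "c \<noteq> \<one>\<^bsub>G\<^esub>" using a(2) c(2) right.iota.hom_one by auto
    then have h: "h \<in> carrier G" "h \<notin> C" using malnormal[of g c] g c(1) cG by (auto simp: h_def)
    have "emb_right a = emb_left c" using emb_agree[OF c(1)] c(2) by simp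
    then have conj_h: "inv\<^bsub>P\<^esub> cls u \<otimes>\<^bsub>P\<^esub> emb_right a \<otimes>\<^bsub>P\<^esub> cls u =
        inv\<^bsub>P\<^esub> cls u' \<otimes>\<^bsub>P\<^esub> emb_left h \<otimes>\<^bsub>P\<^esub> cls u'"
      using P.conj_conj[OF emb_left_closed[OF g(1)] cls_closed[OF reduced_words[OF g(3)]] emb_left_closed[OF cG]]
        emb_left_cls[OF g(1) reduced_words[OF g(3)]] emb_left_conj[OF cG g(1)]
      by (simp add: u' h_def)
    show False
    \<comment> \<open>If no letter remains, the conjugate is \<open>h\<close> in \<open>G\<close>
      outside \<open>C\<close>, whose single side differs from that of \<open>A\<close>; otherwise
      the next letter lies in \<open>A\<close> and conjugation lengthens \<open>h\<close>.\<close>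
    proof (cases "u' = []")
      case True
      then have "emb_left h \<in> emb_right ` carrier A"
        using u(4) conj_h emb_left_closed[OF h(1)] by (simp add: one_P[symmetric])
      then show False using sides_emb_left[OF h(1)] h(2) sides_emb_right by (auto split: if_splits)
    next
      case False
      have "isl (Inl h) \<noteq> isl (hd u')" using u(1) u' False by (simp add: reduced_Cons)
      then show False
        using len_conj_reduced[OF g(3) False, of "Inl h"] h conj_h u(4) len_factor
        by (force simp: emb_left_def)
    qed
  qed
qed

text \<open>A leading letter of \<open>X\<close> in \<open>G\<close> merely replaces
  \<open>g\<close> by a conjugate in \<open>G\<close>, still outside \<open>C\<close> by hypothesis.
  The remaining word starts in \<open>A\<close>, so conjugating by it gives an element too long for
  a factor.\<close>

lemma left_malnormal:
  assumes g: "g \<in> carrier G" "\<And>h. h \<in> carrier G \<Longrightarrow> inv\<^bsub>G\<^esub> h \<otimes>\<^bsub>G\<^esub> g \<otimes>\<^bsub>G\<^esub> h \<notin> C"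
    and X: "X \<in> carrier P"
    and conj: "inv\<^bsub>P\<^esub> X \<otimes>\<^bsub>P\<^esub> emb_left g \<otimes>\<^bsub>P\<^esub> X \<in> emb_left ` carrier G"
  shows "X \<in> emb_left ` carrier G"
proof (rule ccontr)
  assume notin: "X \<notin> emb_left ` carrier G"
  have eg: "emb_left g \<in> carrier P" by (rule emb_left_closed[OF g(1)])
  have "X \<notin> emb_left ` C" using notin C_sub by auto
  then obtain w where w: "reduced w" "w \<noteq> []" "X = cls w" using reduced_form[OF X] by blast
  have "\<exists>u h. reduced u \<and> u \<noteq> [] \<and> \<not> isl (hd u) \<and> proper (Inl h) \<and>
    inv\<^bsub>P\<^esub> X \<otimes>\<^bsub>P\<^esub> emb_left g \<otimes>\<^bsub>P\<^esub> X = inv\<^bsub>P\<^esub> cls u \<otimes>\<^bsub>P\<^esub> cls [Inl h] \<otimes>\<^bsub>P\<^esub> cls u"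
  proof (cases "hd w")
    case (Inr b)
    have "g \<notin> C" using g(2)[OF G.one_closed] g(1) by simp
    then show ?thesis using w g(1) Inr by (intro exI[of _ w] exI[of _ g]) (simp add: emb_left_def)
  next
    case (Inl h)
    then obtain w' where w': "w = Inl h # w'" using w(2) by (cases w) auto
    then have h: "h \<in> carrier G" "reduced w'" using w(1) by (auto simp: reduced_Cons)
    have "w' \<noteq> []" using notin w(3) w' h by (auto simp: emb_left_def)
    moreover from this have "\<not> isl (hd w')" using w(1) w' by (simp add: reduced_Cons)
    moreover have "X = emb_left h \<otimes>\<^bsub>P\<^esub> cls w'"
      using w(3) w' emb_left_cls[OF h(1) reduced_words[OF h(2)]] by simp
    then have "inv\<^bsub>P\<^esub> X \<otimes>\<^bsub>P\<^esub> emb_left g \<otimes>\<^bsub>P\<^esub> X =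
        inv\<^bsub>P\<^esub> cls w' \<otimes>\<^bsub>P\<^esub> cls [Inl (inv\<^bsub>G\<^esub> h \<otimes>\<^bsub>G\<^esub> g \<otimes>\<^bsub>G\<^esub> h)] \<otimes>\<^bsub>P\<^esub> cls w'"
      using P.conj_conj[OF emb_left_closed[OF h(1)] cls_closed[OF reduced_words[OF h(2)]] eg]
        emb_left_conj[OF g(1) h(1)] by (simp add: emb_left_def[symmetric])
    moreover have "proper (Inl (inv\<^bsub>G\<^esub> h \<otimes>\<^bsub>G\<^esub> g \<otimes>\<^bsub>G\<^esub> h))" using g h by simp
    ultimately show ?thesis using h(2) by blast
  qed
  then obtain u h where u: "reduced u" "u \<noteq> []" "\<not> isl (hd u)" "proper (Inl h)"
    "inv\<^bsub>P\<^esub> X \<otimes>\<^bsub>P\<^esub> emb_left g \<otimes>\<^bsub>P\<^esub> X = inv\<^bsub>P\<^esub> cls u \<otimes>\<^bsub>P\<^esub> cls [Inl h] \<otimes>\<^bsub>P\<^esub> cls u" by blast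
  have "len (inv\<^bsub>P\<^esub> X \<otimes>\<^bsub>P\<^esub> emb_left g \<otimes>\<^bsub>P\<^esub> X) > 1"
    unfolding u(5) using u by (intro len_conj_reduced) auto
  then show False using len_factor[OF UnI1[OF conj]] by simp
qed

text \<open>Elements of \<open>G\<close> conjugate in \<open>G\<close> into \<open>C\<close> are
  moved to \<open>A\<close> by \<open>\<phi>\<close>. The two cases thus match
  \<open>right_malnormal\<close> and \<open>left_malnormal\<close>.\<close>

lemma elliptic_cases:
  assumes X: "X \<in> carrier P" and ell: "elliptic X"
  obtains (right) p a where "p \<in> carrier P" "a \<in> carrier A"
      "inv\<^bsub>P\<^esub> p \<otimes>\<^bsub>P\<^esub> X \<otimes>\<^bsub>P\<^esub> p = emb_right a"
  | (left) p g where "p \<in> carrier P" "g \<in> carrier G"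
      "inv\<^bsub>P\<^esub> p \<otimes>\<^bsub>P\<^esub> X \<otimes>\<^bsub>P\<^esub> p = emb_left g"
      "\<And>h. h \<in> carrier G \<Longrightarrow> inv\<^bsub>G\<^esub> h \<otimes>\<^bsub>G\<^esub> g \<otimes>\<^bsub>G\<^esub> h \<notin> C"
proof -
  obtain p where p: "p \<in> carrier P"
    "inv\<^bsub>P\<^esub> p \<otimes>\<^bsub>P\<^esub> X \<otimes>\<^bsub>P\<^esub> p \<in> emb_left ` carrier G \<union> emb_right ` carrier A"
    using ell unfolding elliptic_def by blast
  from p(2) show thesis
  proof
    assume "inv\<^bsub>P\<^esub> p \<otimes>\<^bsub>P\<^esub> X \<otimes>\<^bsub>P\<^esub> p \<in> emb_right ` carrier A"
    then show thesis using right[OF p(1)] by blast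
  next
    assume "inv\<^bsub>P\<^esub> p \<otimes>\<^bsub>P\<^esub> X \<otimes>\<^bsub>P\<^esub> p \<in> emb_left ` carrier G"
    then obtain g where g: "g \<in> carrier G" "inv\<^bsub>P\<^esub> p \<otimes>\<^bsub>P\<^esub> X \<otimes>\<^bsub>P\<^esub> p = emb_left g" by blast
    show thesis
    proof (cases "\<exists>h \<in> carrier G. inv\<^bsub>G\<^esub> h \<otimes>\<^bsub>G\<^esub> g \<otimes>\<^bsub>G\<^esub> h \<in> C")
      case True
      then obtain h where h: "h \<in> carrier G" "inv\<^bsub>G\<^esub> h \<otimes>\<^bsub>G\<^esub> g \<otimes>\<^bsub>G\<^esub> h \<in> C" by blast
      have "inv\<^bsub>P\<^esub> (p \<otimes>\<^bsub>P\<^esub> emb_left h) \<otimes>\<^bsub>P\<^esub> X \<otimes>\<^bsub>P\<^esub> (p \<otimes>\<^bsub>P\<^esub> emb_left h) =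
          emb_right (\<phi> (inv\<^bsub>G\<^esub> h \<otimes>\<^bsub>G\<^esub> g \<otimes>\<^bsub>G\<^esub> h))"
        unfolding emb_agree[OF h(2), symmetric] emb_left_conj[OF g(1) h(1), symmetric]
          P.conj_conj[OF p(1) emb_left_closed[OF h(1)] X, symmetric] g(2) by (rule HOL.refl)
      then show thesis
        using right[OF _ phi_C_closed[OF h(2)]] p(1) emb_left_closed[OF h(1)] by blast
    next
      case False
      then show thesis using left[OF p(1) g] by blast
    qed
  qed
qed

lemma elliptic_conjI:
  assumes "p \<in> carrier P" "X \<in> carrier P" "elliptic (inv\<^bsub>P\<^esub> p \<otimes>\<^bsub>P\<^esub> X \<otimes>\<^bsub>P\<^esub> p)"
  shows "elliptic X"
proof -
  obtain q where q: "q \<in> carrier P" "inv\<^bsub>P\<^esub> q \<otimes>\<^bsub>P\<^esub> (inv\<^bsub>P\<^esub> p \<otimes>\<^bsub>P\<^esub> X \<otimes>\<^bsub>P\<^esub> p) \<otimes>\<^bsub>P\<^esub> q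
      \<in> emb_left ` carrier G \<union> emb_right ` carrier A"
    using assms(3) unfolding elliptic_def by blast
  then show ?thesis
    unfolding elliptic_def P.conj_conj[OF assms(1) q(1) assms(2)] using assms(1) by blast
qed

lemma elliptic_factor:
  assumes "X \<in> emb_left ` carrier G \<union> emb_right ` carrier A"
  shows "elliptic X"
proof -
  have "X \<in> carrier P" using assms emb_left_closed emb_right_closed by blast
  then have "inv\<^bsub>P\<^esub> \<one>\<^bsub>P\<^esub> \<otimes>\<^bsub>P\<^esub> X \<otimes>\<^bsub>P\<^esub> \<one>\<^bsub>P\<^esub> = X" by simp
  then show ?thesis unfolding elliptic_def using assms by (intro bexI[of _ "\<one>\<^bsub>P\<^esub>"]) simp_all
qed

text \<open>After conjugating \<open>Z\<close> into a factor, the corresponding conjugate of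
  \<open>X\<close> fixes it, and malnormality puts that conjugate into the same factor. This
  supplies the assumption \<open>rigid\<close> for hyperbolic elements.\<close>

lemma elliptic_if_commutes:
  assumes Z: "Z \<in> carrier P" "Z \<noteq> \<one>\<^bsub>P\<^esub>" "elliptic Z" and X: "X \<in> carrier P"
    and comm: "Z \<otimes>\<^bsub>P\<^esub> X = X \<otimes>\<^bsub>P\<^esub> Z"
  shows "elliptic X"
proof -
  have comm': "inv\<^bsub>P\<^esub> (inv\<^bsub>P\<^esub> p \<otimes>\<^bsub>P\<^esub> X \<otimes>\<^bsub>P\<^esub> p) \<otimes>\<^bsub>P\<^esub> (inv\<^bsub>P\<^esub> p \<otimes>\<^bsub>P\<^esub> Z \<otimes>\<^bsub>P\<^esub> p) \<otimes>\<^bsub>P\<^esub> (inv\<^bsub>P\<^esub> p \<otimes>\<^bsub>P\<^esub> X \<otimes>\<^bsub>P\<^esub> p)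
      = inv\<^bsub>P\<^esub> p \<otimes>\<^bsub>P\<^esub> Z \<otimes>\<^bsub>P\<^esub> p" if p: "p \<in> carrier P" for p
  proof (subst P.conj_fixes_iff)
    show "inv\<^bsub>P\<^esub> p \<otimes>\<^bsub>P\<^esub> X \<otimes>\<^bsub>P\<^esub> p \<otimes>\<^bsub>P\<^esub> (inv\<^bsub>P\<^esub> p \<otimes>\<^bsub>P\<^esub> Z \<otimes>\<^bsub>P\<^esub> p) =
        inv\<^bsub>P\<^esub> p \<otimes>\<^bsub>P\<^esub> Z \<otimes>\<^bsub>P\<^esub> p \<otimes>\<^bsub>P\<^esub> (inv\<^bsub>P\<^esub> p \<otimes>\<^bsub>P\<^esub> X \<otimes>\<^bsub>P\<^esub> p)"
      using P.conj_mult[OF p X Z(1)] P.conj_mult[OF p Z(1) X] comm by metis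
  qed (use p X Z(1) in simp_all)
  from Z(1,3) show ?thesis
  proof (cases rule: elliptic_cases)
    case (right p a)
    have "a \<noteq> \<one>\<^bsub>A\<^esub>" using right Z P.conj_eq_one_iff[OF right(1) Z(1)] emb_right_one by auto
    then have "inv\<^bsub>P\<^esub> p \<otimes>\<^bsub>P\<^esub> X \<otimes>\<^bsub>P\<^esub> p \<in> emb_right ` carrier A"
      using right_malnormal[OF right(2), of "inv\<^bsub>P\<^esub> p \<otimes>\<^bsub>P\<^esub> X \<otimes>\<^bsub>P\<^esub> p"] comm'[OF right(1)] right X
      by simp
    then show ?thesis using elliptic_conjI[OF right(1) X] elliptic_factor by blast
  next
    case (left p g)
    have "inv\<^bsub>P\<^esub> p \<otimes>\<^bsub>P\<^esub> X \<otimes>\<^bsub>P\<^esub> p \<in> emb_left ` carrier G"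
      using left_malnormal[OF left(2,4), of "inv\<^bsub>P\<^esub> p \<otimes>\<^bsub>P\<^esub> X \<otimes>\<^bsub>P\<^esub> p"] comm'[OF left(1)] left(1,2,3) X
      by simp
    then show ?thesis using elliptic_conjI[OF left(1) X] elliptic_factor by blast
  qed
qed

section \<open>The CSA condition in the amalgam\<close>

lemma commutes_conj_fixes:
  assumes "X \<in> carrier P" "Y \<in> carrier P" "X \<otimes>\<^bsub>P\<^esub> Y = Y \<otimes>\<^bsub>P\<^esub> X"
  shows "inv\<^bsub>P\<^esub> X \<otimes>\<^bsub>P\<^esub> Y \<otimes>\<^bsub>P\<^esub> X = Y"
  using P.conj_fixes_iff assms by blast

text \<open>By malnormality the centralizer of \<open>a\<close> lies in the abelian
  \<open>A\<close>. A conjugate of \<open>a\<close> commuting with \<open>a\<close> therefore lies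
  in \<open>A\<close>, and malnormality again puts the conjugating element there.\<close>

lemma CSA_element_emb_right:
  assumes a: "a \<in> carrier A" "a \<noteq> \<one>\<^bsub>A\<^esub>"
  shows "CSA_element P (emb_right a)"
proof -
  note ea = emb_right_closed[OF a(1)]
  have cent: "X \<in> emb_right ` carrier A"
    if "X \<in> carrier P" "X \<otimes>\<^bsub>P\<^esub> emb_right a = emb_right a \<otimes>\<^bsub>P\<^esub> X" for X
    using right_malnormal[OF a that(1)] commutes_conj_fixes[OF that(1) ea that(2)] a(1) by simp
  show ?thesis
    unfolding CSA_element_def
  proof (intro conjI ballI impI)
    fix X Y assume XY: "X \<in> carrier P" "Y \<in> carrier P"
      "X \<otimes>\<^bsub>P\<^esub> emb_right a = emb_right a \<otimes>\<^bsub>P\<^esub> X" "Y \<otimes>\<^bsub>P\<^esub> emb_right a = emb_right a \<otimes>\<^bsub>P\<^esub> Y"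
    obtain x where x: "x \<in> carrier A" "X = emb_right x" using cent[OF XY(1,3)] by blast
    obtain y where y: "y \<in> carrier A" "Y = emb_right y" using cent[OF XY(2,4)] by blast
    show "X \<otimes>\<^bsub>P\<^esub> Y = Y \<otimes>\<^bsub>P\<^esub> X"
      unfolding x(2) y(2) by (rule emb_right_comm[OF x(1) y(1)])
  next
    fix X assume X: "X \<in> carrier P" "inv\<^bsub>P\<^esub> X \<otimes>\<^bsub>P\<^esub> emb_right a \<otimes>\<^bsub>P\<^esub> X \<otimes>\<^bsub>P\<^esub> emb_right a =
      emb_right a \<otimes>\<^bsub>P\<^esub> (inv\<^bsub>P\<^esub> X \<otimes>\<^bsub>P\<^esub> emb_right a \<otimes>\<^bsub>P\<^esub> X)"
    have "X \<in> emb_right ` carrier A"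
      by (rule right_malnormal[OF a X(1) cent[OF P.conj_closed[OF X(1) ea] X(2)]])
    then obtain x where x: "x \<in> carrier A" "X = emb_right x" by blast
    show "X \<otimes>\<^bsub>P\<^esub> emb_right a = emb_right a \<otimes>\<^bsub>P\<^esub> X"
      unfolding x(2) by (rule emb_right_comm[OF x(1) a(1)])
  qed
qed

text \<open>Malnormality brings all elements involved into \<open>G\<close>, and injectivity of
  \<open>emb_left\<close> transfers commutation back and forth.\<close>

lemma CSA_element_emb_left:
  assumes g: "g \<in> carrier G" "\<And>h. h \<in> carrier G \<Longrightarrow> inv\<^bsub>G\<^esub> h \<otimes>\<^bsub>G\<^esub> g \<otimes>\<^bsub>G\<^esub> h \<notin> C"
    and G: "CSA_element G g"
  shows "CSA_element P (emb_left g)"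
proof -
  note eg = emb_left_closed[OF g(1)]
  have cent: "X \<in> emb_left ` carrier G"
    if "X \<in> carrier P" "X \<otimes>\<^bsub>P\<^esub> emb_left g = emb_left g \<otimes>\<^bsub>P\<^esub> X" for X
    using left_malnormal[OF g that(1)] commutes_conj_fixes[OF that(1) eg that(2)] g(1) by simp
  have comm: "emb_left x \<otimes>\<^bsub>P\<^esub> emb_left y = emb_left y \<otimes>\<^bsub>P\<^esub> emb_left x \<longleftrightarrow> x \<otimes>\<^bsub>G\<^esub> y = y \<otimes>\<^bsub>G\<^esub> x"
    if "x \<in> carrier G" "y \<in> carrier G" for x y
    using emb_left_mult[OF that] emb_left_mult[OF that(2,1)]
      emb_left_inj[OF G.m_closed[OF that] G.m_closed[OF that(2,1)]] by metis
  show ?thesis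
    unfolding CSA_element_def
  proof (intro conjI ballI impI)
    fix X Y assume XY: "X \<in> carrier P" "Y \<in> carrier P" "X \<otimes>\<^bsub>P\<^esub> emb_left g = emb_left g \<otimes>\<^bsub>P\<^esub> X"
      "Y \<otimes>\<^bsub>P\<^esub> emb_left g = emb_left g \<otimes>\<^bsub>P\<^esub> Y"
    obtain x where x: "x \<in> carrier G" "X = emb_left x" using cent[OF XY(1,3)] by blast
    obtain y where y: "y \<in> carrier G" "Y = emb_left y" using cent[OF XY(2,4)] by blast
    have "x \<otimes>\<^bsub>G\<^esub> y = y \<otimes>\<^bsub>G\<^esub> x"
      using CSA_elementD(1)[OF G x(1) y(1)] XY(3,4) comm[OF x(1) g(1)] comm[OF y(1) g(1)]
      unfolding x(2) y(2) by blast
    then show "X \<otimes>\<^bsub>P\<^esub> Y = Y \<otimes>\<^bsub>P\<^esub> X" unfolding x(2) y(2) comm[OF x(1) y(1)] .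
  next
    fix X assume X: "X \<in> carrier P" "inv\<^bsub>P\<^esub> X \<otimes>\<^bsub>P\<^esub> emb_left g \<otimes>\<^bsub>P\<^esub> X \<otimes>\<^bsub>P\<^esub> emb_left g =
      emb_left g \<otimes>\<^bsub>P\<^esub> (inv\<^bsub>P\<^esub> X \<otimes>\<^bsub>P\<^esub> emb_left g \<otimes>\<^bsub>P\<^esub> X)"
    have "X \<in> emb_left ` carrier G"
      by (rule left_malnormal[OF g X(1) cent[OF P.conj_closed[OF X(1) eg] X(2)]])
    then obtain x where x: "x \<in> carrier G" "X = emb_left x" by blast
    have "(inv\<^bsub>G\<^esub> x \<otimes>\<^bsub>G\<^esub> g \<otimes>\<^bsub>G\<^esub> x) \<otimes>\<^bsub>G\<^esub> g = g \<otimes>\<^bsub>G\<^esub> (inv\<^bsub>G\<^esub> x \<otimes>\<^bsub>G\<^esub> g \<otimes>\<^bsub>G\<^esub> x)"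
      using X(2) comm[OF G.conj_closed[OF x(1) g(1)] g(1)]
      unfolding x(2) emb_left_conj[OF g(1) x(1)] by blast
    then have "x \<otimes>\<^bsub>G\<^esub> g = g \<otimes>\<^bsub>G\<^esub> x" by (rule CSA_elementD(2)[OF G x(1)])
    then show "X \<otimes>\<^bsub>P\<^esub> emb_left g = emb_left g \<otimes>\<^bsub>P\<^esub> X" unfolding x(2) comm[OF x(1) g(1)] .
  qed
qed

lemma CSA_star_amalgam:
  assumes G: "CSA_star G" and A2: "no_order_two A"
  shows "CSA_star P"
proof -
  have G_csa: "CSA_element G g" if "g \<in> carrier G" "g \<noteq> \<one>\<^bsub>G\<^esub>" for g
    using G G.CSA_group_iff that by (auto simp: CSA_star_def)
  have P2: "no_order_two P"
    using G A2 by (intro no_order_two_amalgam) (simp_all add: CSA_star_def)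
  have "CSA_element P X" if X: "X \<in> carrier P" "X \<noteq> \<one>\<^bsub>P\<^esub>" for X
  proof (cases "elliptic X")
    case True
    from X(1) this show ?thesis
    proof (cases rule: elliptic_cases)
      case (right p a)
      have "a \<noteq> \<one>\<^bsub>A\<^esub>"
        using right X P.conj_eq_one_iff[OF right(1) X(1)] emb_right_one by auto
      then have "CSA_element P (inv\<^bsub>P\<^esub> p \<otimes>\<^bsub>P\<^esub> X \<otimes>\<^bsub>P\<^esub> p)"
        unfolding right(3) by (rule CSA_element_emb_right[OF right(2)])
      then show ?thesis by (rule P.CSA_element_conj[OF right(1) X(1)])
    next
      case (left p g)
      have "g \<noteq> \<one>\<^bsub>G\<^esub>" using left(4)[OF G.one_closed] one_in_C by auto
      then have "CSA_element P (inv\<^bsub>P\<^esub> p \<otimes>\<^bsub>P\<^esub> X \<otimes>\<^bsub>P\<^esub> p)"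
        unfolding left(3) by (intro CSA_element_emb_left left(2,4) G_csa)
      then show ?thesis by (rule P.CSA_element_conj[OF left(1) X(1)])
    qed
  next
    case False
    then have hyp: "tree.hyperbolic X" using elliptic_or_hyperbolic[OF X(1)] by blast
    show ?thesis
    \<comment> \<open>The assumption \<open>rigid\<close> holds because a nontrivial elliptic
      \<open>Z\<close> commuting with \<open>X\<close> would make \<open>X\<close> elliptic.\<close>
    proof (rule tree.CSA_element_hyperbolic[OF hyp _ P2])
      fix Z assume Z: "Z \<in> carrier P" "Z \<otimes>\<^bsub>P\<^esub> X = X \<otimes>\<^bsub>P\<^esub> Z" "\<not> tree.hyperbolic Z"
      then have "elliptic Z" using elliptic_or_hyperbolic by blast
      then show "Z = \<one>\<^bsub>P\<^esub>" using elliptic_if_commutes[OF Z(1) _ _ X(1) Z(2)] False by blast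
    qed
  qed
  then show ?thesis using P2 P.CSA_group_iff by (simp add: CSA_star_def)
qed

end

section \<open>Centralizers in CSA-groups and the conclusion\<close>

lemma (in group) subgroup_centralizer:
  assumes v: "v \<in> carrier G"
  shows "subgroup (centralizer G v) G"
proof (rule subgroupI)
  show "centralizer G v \<noteq> {}" using v by (auto simp: centralizer_def)
  fix x assume x: "x \<in> centralizer G v"
  then show "inv x \<in> centralizer G v" using v inv_commute[of x v] by (simp add: centralizer_def)
  fix y assume "y \<in> centralizer G v"
  then show "x \<otimes> y \<in> centralizer G v" using x v mult_commute[of x y v] by (simp add: centralizer_def)
qed (auto simp: centralizer_def)

text \<open>The conjugate of \<open>c\<close> and \<open>c\<close> itself both centralize
  \<open>v\<close>, which is nontrivial as \<open>g\<close> does not commute with it, so they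
  commute. The CSA condition at \<open>c\<close> makes \<open>g\<close> commute with
  \<open>c\<close>. Both \<open>g\<close> and \<open>v\<close> then lie in the abelian centralizer
  of \<open>c\<close>, a contradiction.\<close>

lemma (in group) centralizer_malnormal:
  assumes csa: "CSA_group G" and v: "v \<in> carrier G" and g: "g \<in> carrier G - centralizer G v"
    and c: "c \<in> centralizer G v" "inv g \<otimes> c \<otimes> g \<in> centralizer G v"
  shows "c = \<one>"
proof (rule ccontr)
  assume "c \<noteq> \<one>"
  have cc: "c \<in> carrier G" "c \<otimes> v = v \<otimes> c" and gc: "g \<in> carrier G" "g \<otimes> v \<noteq> v \<otimes> g"
    and k: "inv g \<otimes> c \<otimes> g \<in> carrier G" "inv g \<otimes> c \<otimes> g \<otimes> v = v \<otimes> (inv g \<otimes> c \<otimes> g)"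
    using c g by (auto simp: centralizer_def)
  have "v \<noteq> \<one>" using gc by auto
  then have ev: "CSA_element G v" and ec: "CSA_element G c"
    using csa v cc \<open>c \<noteq> \<one>\<close> unfolding CSA_group_iff by auto
  have "g \<otimes> c = c \<otimes> g"
    by (rule CSA_elementD(2)[OF ec gc(1) CSA_elementD(1)[OF ev k(1) cc(1) k(2) cc(2)]])
  then have "g \<otimes> v = v \<otimes> g"
    by (rule CSA_elementD(1)[OF ec gc(1) v _ cc(2)[symmetric]])
  with gc show False by simp
qed

theorem theorem5:
  fixes G :: "('a, 'm) monoid_scheme" and A :: "('b, 'n) monoid_scheme"
    and v :: 'a and \<phi> :: "'a \<Rightarrow> 'b"
  assumes "CSA_star G"
    and "v \<in> carrier G"
    and "comm_group A"
    and "no_order_two A"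
    and "\<phi> \<in> mon (G\<lparr>carrier := centralizer G v\<rparr>) A"
  shows "CSA_star (centralizer_extension G v A \<phi>)"
proof -
  have csa: "CSA_group G" using assms(1) by (simp add: CSA_star_def)
  interpret G: group G using csa by (simp add: CSA_group_def)
  interpret A: comm_group A by fact
  have "\<phi> \<in> hom (G\<lparr>carrier := centralizer G v\<rparr>) A" using assms(5) by (simp add: mon_def)
  then have phi: "\<phi> ` centralizer G v \<subseteq> carrier A" by (auto simp: hom_def)
  interpret malnormal_amalgam G A "centralizer G v" \<phi>
  proof (intro malnormal_amalgam.intro malnormal_amalgam_axioms.intro amalgam_mon.intro
      amalgam_mon_axioms.intro amalgam.intro amalgam_axioms.intro)
    show "group G" "group A" by (rule G.is_group A.is_group)+
    show "centralizer G v \<subseteq> carrier G" by (auto simp: centralizer_def)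
    show "\<phi> ` centralizer G v \<subseteq> carrier A" by (rule phi)
    show "subgroup (centralizer G v) G" by (rule G.subgroup_centralizer[OF assms(2)])
    show "\<phi> \<in> mon (G\<lparr>carrier := centralizer G v\<rparr>) A" by fact
    show "x \<otimes>\<^bsub>A\<^esub> y = y \<otimes>\<^bsub>A\<^esub> x" if "x \<in> carrier A" "y \<in> carrier A" for x y
      using that by (rule A.m_comm)
    show "c = \<one>\<^bsub>G\<^esub>" if "g \<in> carrier G - centralizer G v" "c \<in> centralizer G v"
      "inv\<^bsub>G\<^esub> g \<otimes>\<^bsub>G\<^esub> c \<otimes>\<^bsub>G\<^esub> g \<in> centralizer G v" for g c
      by (rule G.centralizer_malnormal[OF csa assms(2) that])
  qed
  show ?thesis
    unfolding centralizer_extension_def by (rule CSA_star_amalgam[OF assms(1,4)])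
qed

end
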